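(* Let $f,g\in L^{1}\cap L^{2}(\mathbb{R}^2,\mathbb{H})$, and suppose $\mathcal{L}^{\mu,\mu}[f]\in L^{p}(\mathbb{R}^2,\mathbb{H})$, with $p$ an integer, $1\le p\le\infty$, and $\mathcal{L}^{\mu,\mu}[g]\in L^{1}(\mathbb{R}^2,\mathbb{H})$, where $\mathcal L^{\mu,\pm\mu}=\mathcal L^{\mu,\pm\mu}_{A_1,A_2}$. Write $f=f_a+f_b\nu$, $g=g_a+\nu\overline{g_b}$ with $f_a,f_b,g_a,g_b$ valued in $\mathbb H(\mu)$, and put $\breve{A}_{i}=\begin{pmatrix}2a_{i}&b_{i}\\ \frac{1}{b_{i}}+2c_{i}&d_{i}\end{pmatrix}$ for $i=1,2$. Then $$\begin{aligned}\mathcal{L}^{\mu,\mu}\big[e^{\mu\frac{a_{1}}{2b_{1}}x^{2}}f(x,y)g(x,y)e^{\mu\frac{a_{2}}{2b_{2}}y^{2}}\big](u,v)={}&\Big(\mathcal{L}^{\mu,\mu}[f_{a}]\circledast_{A_{1}^{-1},A_{2}^{-1}}\mathcal{L}^{\mu,\mu}[g_{a}](u,v)-\mathcal{L}^{\mu,\mu}[f_{b}]\circledast_{A_{1}^{-1},A_{2}^{-1}}\mathcal{L}^{\mu,\mu}[\overline{g_{b}}](u,v)\Big)\\&+\Big(\mathcal{L}^{\mu,-\mu}[f_{b}]\circledast_{A_{1}^{-1},A_{2}^{-1}}\mathcal{L}^{\mu,-\mu}[\overline{g_{a}}](u,v)+\mathcal{L}^{\mu,-\mu}[f_{a}]\circledast_{A_{1}^{-1},A_{2}^{-1}}\mathcal{L}^{\mu,-\mu}[g_{b}](u,v)\Big)\nu\end{aligned}$$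 and $$\begin{aligned}\mathcal{L}^{\mu,\mu}_{\breve{A}_{1},\breve{A}_{2}}[fg](u,v)={}&\Big(\mathcal{L}^{\mu,\mu}[f_{a}]\circledast_{A_{1}^{-1},A_{2}^{-1}}\mathcal{L}^{\mu,\mu}[g_{a}](u,v)-\mathcal{L}^{\mu,\mu}[f_{b}]\circledast_{A_{1}^{-1},A_{2}^{-1}}\mathcal{L}^{\mu,\mu}[\overline{g_{b}}](u,v)\Big)\\&+\Big(\mathcal{L}^{\mu,-\mu}[f_{b}]\circledast_{A_{1}^{-1},A_{2}^{-1}}\mathcal{L}^{\mu,-\mu}[\overline{g_{a}}](u,v)+\mathcal{L}^{\mu,-\mu}[f_{a}]\circledast_{A_{1}^{-1},A_{2}^{-1}}\mathcal{L}^{\mu,-\mu}[g_{b}](u,v)\Big)\nu .\end{aligned}$$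
   Context: $\mathbb H=\{q_r+\mu q_\mu+\nu q_\nu+\eta q_\eta: q_r,q_\mu,q_\nu,q_\eta\in\mathbb R\}$ is the quaternion algebra with $\mu^2=\nu^2=\eta^2=\mu\nu\eta=-1$, $\mu\nu=-\nu\mu=\eta$, conjugation $\overline q=q_r-\mu q_\mu-\nu q_\nu-\eta q_\eta$, and modulus $|q|=\sqrt{q\overline q}$. $\mathbb H(\mu)=\{q_r+\mu q_\mu:q_r,q_\mu\in\mathbb R\}$. Every $f:\mathbb R^2\to\mathbb H$ can be written uniquely as $f=f_a+f_b\nu=f_a+\nu\overline{f_b}$ with $f_a,f_b$ valued in $\mathbb H(\mu)$. $L^p(\mathbb R^2,\mathbb H)$ is the space of $f:\mathbb R^2\to\mathbb H$ with $\|f\|_p=(\int_{\mathbb R^2}|f|^p\,dx\,dy)^{1/p}<\infty$ (essential supremum of $|f|$ for $p=\infty$). $A_i=\begin{pmatrix}a_i&b_i\\c_i&d_i\end{pmatrix}$, $i=1,2$, are real matrices with $a_id_i-b_ic_i=1$ and $b_i\neq0$; $A_i^{-1}=\begin{pmatrix}d_i&-b_i\\-c_i&a_i\end{pmatrix}$. For $\lambda\in\{\mu,-\mu\}$ and a real matrix $A=\begin{pmatrix}a&b\\c&d\end{pmatrix}$ of determinant $1$ with $b\neq0$, $$K_A^{\lambda}(x,u)=\frac{1}{\sqrt{2\pi b\lambda}}\,e^{\lambda(\frac{a}{2b}x^2-\frac1b xu+\frac{d}{2b}u^2)},\qquad W_A^\lambda(t,\tau)=\frac{1}{\sqrt{2\pi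 b\lambda}}\,e^{\lambda\tau(\tau-t)\frac ab},$$ with the principal square root in $\mathbb H(\mu)\cong\mathbb C$. For such matrices $B_1,B_2$ and integrable $f$, the quaternion linear canonical transform is $\mathcal L^{\mu,\pm\mu}_{B_1,B_2}[f](u,v)=\int_{\mathbb R^2}K^{\mu}_{B_1}(x,u)f(x,y)K^{\pm\mu}_{B_2}(y,v)\,dx\,dy$, and the spatial convolution $\circledast_{B_1,B_2}=\circledast^{\mu,\mu}_{B_1,B_2}$ is $$(F\circledast_{B_1,B_2} G)(u,v)=\int_{\mathbb R^2}W_{B_1}^{\mu}(u,\tau_1)F(\tau_1,\tau_2)G(u-\tau_1,v-\tau_2)W_{B_2}^{\mu}(v,\tau_2)\,d\tau_1d\tau_2 .$$
   Formalization: In both identities, the two terms multiplied by ν on the right use the convolution with superscripts (μ,−μ), whose second weight is W^{−μ}, instead of the (μ,μ) one; with the (μ,μ) convolution the identities fail, e.g. for f=h, g=hν with h a Gaussian and a_i=d_i=0, b_i=1. *)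

theory Defs
  imports "HOL-Analysis.Analysis" "HOL-Probability.Essential_Supremum" "HOL-Library.Extended_Nat"
begin

section \<open>Quaternions\<close>

text \<open>\<open>Quat r m n e\<close> is \<open>r + \<mu> m + \<nu> n + \<eta> e\<close>.\<close>

codatatype quat = Quat (qre: real) (qmu: real) (qnu: real) (qeta: real)

lemma quat_eqI [intro?]:
  "qre x = qre y \<Longrightarrow> qmu x = qmu y \<Longrightarrow> qnu x = qnu y \<Longrightarrow> qeta x = qeta y \<Longrightarrow> x = y"
  by (rule quat.expand) simp

lemma quat_eq_iff:
  "x = y \<longleftrightarrow> qre x = qre y \<and> qmu x = qmu y \<and> qnu x = qnu y \<and> qeta x = qeta y"
  by (auto intro: quat.expand)

instantiation quat :: ab_group_add
begin

primcorec zero_quat where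
  "qre 0 = 0" | "qmu 0 = 0" | "qnu 0 = 0" | "qeta 0 = 0"

primcorec plus_quat where
  "qre (x + y) = qre x + qre y"
| "qmu (x + y) = qmu x + qmu y"
| "qnu (x + y) = qnu x + qnu y"
| "qeta (x + y) = qeta x + qeta y"

primcorec uminus_quat where
  "qre (- x) = - qre x"
| "qmu (- x) = - qmu x"
| "qnu (- x) = - qnu x"
| "qeta (- x) = - qeta x"

primcorec minus_quat where
  "qre (x - y) = qre x - qre y"
| "qmu (x - y) = qmu x - qmu y"
| "qnu (x - y) = qnu x - qnu y"
| "qeta (x - y) = qeta x - qeta y"

instance
  by standard (simp_all add: quat_eq_iff)

end

instantiation quat :: ring_1
begin

primcorec one_quat where
  "qre 1 = 1" | "qmu 1 = 0" | "qnu 1 = 0" | "qeta 1 = 0"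

primcorec times_quat where
  "qre (x * y) = qre x * qre y - qmu x * qmu y - qnu x * qnu y - qeta x * qeta y"
| "qmu (x * y) = qre x * qmu y + qmu x * qre y + qnu x * qeta y - qeta x * qnu y"
| "qnu (x * y) = qre x * qnu y - qmu x * qeta y + qnu x * qre y + qeta x * qmu y"
| "qeta (x * y) = qre x * qeta y + qmu x * qnu y - qnu x * qmu y + qeta x * qre y"

instance
  by standard (simp_all add: quat_eq_iff algebra_simps)

end

instantiation quat :: real_algebra_1
begin

primcorec scaleR_quat where
  "qre (scaleR r x) = r * qre x"
| "qmu (scaleR r x) = r * qmu x"
| "qnu (scaleR r x) = r * qnu x"
| "qeta (scaleR r x) = r * qeta x"

instance
  by standard (simp_all add: quat_eq_iff algebra_simps)

end

primcorec qcnj :: "quat \<Rightarrow> quat" where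
  "qre (qcnj x) = qre x"
| "qmu (qcnj x) = - qmu x"
| "qnu (qcnj x) = - qnu x"
| "qeta (qcnj x) = - qeta x"

instantiation quat :: inverse
begin

definition inverse_quat :: "quat \<Rightarrow> quat" where
  "inverse x = qcnj x /\<^sub>R ((qre x)\<^sup>2 + (qmu x)\<^sup>2 + (qnu x)\<^sup>2 + (qeta x)\<^sup>2)"

definition divide_quat :: "quat \<Rightarrow> quat \<Rightarrow> quat" where
  "x div y = x * inverse y" for x y :: quat

instance ..

end

instance quat :: real_div_algebra
proof
  fix x y :: quat
  let ?N = "(qre x)\<^sup>2 + (qmu x)\<^sup>2 + (qnu x)\<^sup>2 + (qeta x)\<^sup>2"
  have nz: "?N \<noteq> 0" if "x \<noteq> 0"
  proof
    assume "?N = 0"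
    then have "(qre x)\<^sup>2 = 0" "(qmu x)\<^sup>2 = 0" "(qnu x)\<^sup>2 = 0" "(qeta x)\<^sup>2 = 0"
      using zero_le_power2[of "qre x"] zero_le_power2[of "qmu x"]
        zero_le_power2[of "qnu x"] zero_le_power2[of "qeta x"] by linarith+
    with that show False by (simp add: quat_eq_iff)
  qed
  have "qcnj x * x = ?N *\<^sub>R 1" "x * qcnj x = ?N *\<^sub>R 1"
    by (simp_all add: quat_eq_iff power2_eq_square algebra_simps)
  with nz show "x \<noteq> 0 \<Longrightarrow> inverse x * x = 1" "x \<noteq> 0 \<Longrightarrow> x * inverse x = 1"
    by (simp_all add: inverse_quat_def)
  show "x / y = x * inverse y"
    by (rule divide_quat_def)
  show "inverse (0::quat) = 0"
    by (simp add: inverse_quat_def quat_eq_iff)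
qed

instantiation quat :: real_inner
begin

definition inner_quat :: "quat \<Rightarrow> quat \<Rightarrow> real" where
  "inner x y = qre x * qre y + qmu x * qmu y + qnu x * qnu y + qeta x * qeta y"

definition norm_quat :: "quat \<Rightarrow> real" where
  "norm x = sqrt ((qre x)\<^sup>2 + (qmu x)\<^sup>2 + (qnu x)\<^sup>2 + (qeta x)\<^sup>2)"

definition sgn_quat :: "quat \<Rightarrow> quat" where
  "sgn x = x /\<^sub>R norm x" for x :: quat

definition dist_quat :: "quat \<Rightarrow> quat \<Rightarrow> real" where
  "dist x y = norm (x - y)" for x y :: quat

definition uniformity_quat :: "(quat \<times> quat) filter" where
  "uniformity = (INF e\<in>{0 <..}. principal {(x, y :: quat). dist x y < e})"

definition open_quat :: "quat set \<Rightarrow> bool" where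
  "open U \<longleftrightarrow> (\<forall>x\<in>U. eventually (\<lambda>(x', y). x' = x \<longrightarrow> y \<in> U) uniformity)" for U :: "quat set"

instance
proof
  fix x y z :: quat and r :: real
  show "inner x y = inner y x"
    by (simp add: inner_quat_def mult.commute)
  show "inner (x + y) z = inner x z + inner y z"
    by (simp add: inner_quat_def algebra_simps)
  show "inner (scaleR r x) y = r * inner x y"
    by (simp add: inner_quat_def algebra_simps)
  show "0 \<le> inner x x"
    by (simp add: inner_quat_def)
  show "inner x x = 0 \<longleftrightarrow> x = 0"
  proof
    assume "inner x x = 0"
    then have "(qre x)\<^sup>2 = 0" "(qmu x)\<^sup>2 = 0" "(qnu x)\<^sup>2 = 0" "(qeta x)\<^sup>2 = 0"
      using zero_le_power2[of "qre x"] zero_le_power2[of "qmu x"]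
        zero_le_power2[of "qnu x"] zero_le_power2[of "qeta x"]
      unfolding inner_quat_def power2_eq_square by linarith+
    then show "x = 0" by (simp add: quat_eq_iff)
  qed (simp add: inner_quat_def)
  show "norm x = sqrt (inner x x)"
    by (simp add: norm_quat_def inner_quat_def power2_eq_square)
qed (rule sgn_quat_def dist_quat_def open_quat_def uniformity_quat_def)+

end

lemma quat_mult_qcnj: "q * qcnj q = of_real ((norm q)\<^sup>2)"
proof -
  have "(norm q)\<^sup>2 = (qre q)\<^sup>2 + (qmu q)\<^sup>2 + (qnu q)\<^sup>2 + (qeta q)\<^sup>2"
    by (simp add: norm_quat_def)
  then show ?thesis
    by (simp add: quat_eq_iff of_real_def power2_eq_square)
qed

lemma qcnj_mult: "qcnj (x * y) = qcnj y * qcnj x"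
  by (simp add: quat_eq_iff)

instance quat :: real_normed_div_algebra
proof
  fix x y :: quat
  have "of_real ((norm (x * y))\<^sup>2) = x * (y * qcnj y) * qcnj x"
    by (simp only: quat_mult_qcnj [symmetric] qcnj_mult mult.assoc)
  also have "\<dots> = of_real ((norm y)\<^sup>2) * (x * qcnj x)"
    unfolding quat_mult_qcnj [of y] by (simp add: of_real_def)
  also have "\<dots> = (of_real ((norm x * norm y)\<^sup>2) :: quat)"
    by (simp only: quat_mult_qcnj of_real_mult [symmetric] power_mult_distrib mult.commute)
  finally have "(norm (x * y))\<^sup>2 = (norm x * norm y)\<^sup>2"
    by (simp only: of_real_eq_iff)
  then show "norm (x * y) = norm x * norm y"
    by (rule power2_eq_imp_eq) simp_all
qed

definition q_mu :: quat  (\<open>\<mu>\<close>) where "\<mu> = Quat 0 1 0 0"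
definition q_nu :: quat  (\<open>\<nu>\<close>) where "\<nu> = Quat 0 0 1 0"
definition q_eta :: quat  (\<open>\<eta>\<close>) where "\<eta> = Quat 0 0 0 1"

lemmas q_units_def = q_mu_def q_nu_def q_eta_def

instantiation quat :: euclidean_space
begin

definition Basis_quat :: "quat set" where
  "Basis = {1, \<mu>, \<nu>, \<eta>}"

instance
proof
  fix u v x :: quat
  show "u \<in> Basis \<Longrightarrow> v \<in> Basis \<Longrightarrow> inner u v = (if u = v then 1 else 0)"
    unfolding Basis_quat_def insert_iff empty_iff
    by (elim disjE FalseE) (simp_all add: q_units_def inner_quat_def quat_eq_iff)
  show "(\<forall>u\<in>Basis. inner x u = 0) \<longleftrightarrow> x = 0"
    unfolding quat_eq_iff [of x 0] by (simp add: Basis_quat_def q_units_def inner_quat_def)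
qed (simp_all add: Basis_quat_def)

end

lemma quat_units:
  "\<mu> * \<mu> = - 1" "\<nu> * \<nu> = - 1" "\<eta> * \<eta> = - 1" "\<mu> * \<nu> * \<eta> = - 1"
  "\<mu> * \<nu> = \<eta>" "\<nu> * \<mu> = - \<eta>"
  by (simp_all add: q_units_def quat_eq_iff)

lemma quat_expand:
  "q = of_real (qre q) + \<mu> * of_real (qmu q) + \<nu> * of_real (qnu q) + \<eta> * of_real (qeta q)"
  by (simp add: q_units_def quat_eq_iff of_real_def)


section \<open>The subfield \<open>\<real> + \<mu> \<real>\<close>\<close>

definition H_mu :: "quat set" where
  "H_mu = {of_real r + \<mu> * of_real s | r s. True}"

lemma H_mu_iff: "q \<in> H_mu \<longleftrightarrow> qnu q = 0 \<and> qeta q = 0"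
proof
  assume "qnu q = 0 \<and> qeta q = 0"
  then have "q = of_real (qre q) + \<mu> * of_real (qmu q)"
    by (simp add: q_units_def quat_eq_iff of_real_def)
  then show "q \<in> H_mu" unfolding H_mu_def by blast
qed (auto simp: H_mu_def q_units_def of_real_def)

lemma H_mu_decomposition: "\<exists>!(a, b). a \<in> H_mu \<and> b \<in> H_mu \<and> q = a + b * \<nu>"
  by (rule ex1I[of _ "(Quat (qre q) (qmu q) 0 0, Quat (qnu q) (qeta q) 0 0)"])
     (auto simp: H_mu_iff q_units_def quat_eq_iff)

lemma H_mu_nu: "b \<in> H_mu \<Longrightarrow> b * \<nu> = \<nu> * qcnj b"
  by (simp add: H_mu_iff q_units_def quat_eq_iff)

definition quat_of_complex :: "complex \<Rightarrow> quat" where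
  "quat_of_complex z = Quat (Re z) (Im z) 0 0"

text \<open>Principal square root on \<open>\<real> + \<mu> \<real>\<close>, transported from the complex numbers along \<open>\<i> \<mapsto> \<mu>\<close>;
  no meaning is intended for arguments outside that subfield.\<close>

definition q_sqrt :: "quat \<Rightarrow> quat" where
  "q_sqrt q = quat_of_complex (csqrt (Complex (qre q) (qmu q)))"


section \<open>Lebesgue spaces of quaternion-valued functions\<close>

text \<open>Integer exponents and \<open>\<infinity>\<close>. Members are functions, not equivalence classes. For finite
  \<open>p\<close> the \<open>p\<close>-th root in the norm is omitted, as only finiteness matters.\<close>

definition Lp :: "enat \<Rightarrow> (real \<times> real \<Rightarrow> quat) set" where
  "Lp p = {f. f \<in> borel_measurable lebesgue \<and>
     (case p of
        enat n \<Rightarrow> (\<integral>\<^sup>+ z. ennreal (norm (f z) ^ n) \<partial>lebesgue) < \<infinity>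
      | \<infinity> \<Rightarrow> esssup lebesgue (\<lambda>z. ereal (norm (f z))) < \<infinity>)}"


section \<open>Linear canonical transform and spatial convolution\<close>

text \<open>The superscripts \<open>l\<close>, \<open>l1\<close>, \<open>l2\<close> stand for \<open>\<mu>\<close> or \<open>- \<mu>\<close>. The spatial convolution has two of them,
  one for each variable, just as the transform has: \<open>qlct l1 l2\<close> over \<open>A1, A2\<close> is compatible with
  \<open>spatial_conv l1 l2\<close> over the inverse matrices. With mismatched superscripts the quadratic phases of
  kernels and weights do not cancel.\<close>

definition lct_kernel :: "quat \<Rightarrow> real^2^2 \<Rightarrow> real \<Rightarrow> real \<Rightarrow> quat" where
  "lct_kernel l A x u =
     1 / q_sqrt (of_real (2 * pi * A$1$2) * l) *
     exp (l * of_real (A$1$1 / (2 * A$1$2) * x\<^sup>2 - 1 / A$1$2 * x * u + A$2$2 / (2 * A$1$2) * u\<^sup>2))"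

definition conv_weight :: "quat \<Rightarrow> real^2^2 \<Rightarrow> real \<Rightarrow> real \<Rightarrow> quat" where
  "conv_weight l A t \<tau> =
     1 / q_sqrt (of_real (2 * pi * A$1$2) * l) *
     exp (l * of_real (\<tau> * (\<tau> - t) * (A$1$1 / A$1$2)))"

definition qlct ::
  "quat \<Rightarrow> quat \<Rightarrow> real^2^2 \<Rightarrow> real^2^2 \<Rightarrow> (real \<times> real \<Rightarrow> quat) \<Rightarrow> real \<times> real \<Rightarrow> quat" where
  "qlct l1 l2 B1 B2 f = (\<lambda>(u, v).
     \<integral>(x, y). lct_kernel l1 B1 x u * f (x, y) * lct_kernel l2 B2 y v \<partial>lebesgue)"

definition spatial_conv ::
  "quat \<Rightarrow> quat \<Rightarrow> real^2^2 \<Rightarrow> real^2^2 \<Rightarrow> (real \<times> real \<Rightarrow> quat) \<Rightarrow> (real \<times> real \<Rightarrow> quat)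
    \<Rightarrow> real \<times> real \<Rightarrow> quat" where
  "spatial_conv l1 l2 B1 B2 F G = (\<lambda>(u, v).
     \<integral>(s, t). conv_weight l1 B1 u s * F (s, t) * G (u - s, v - t) * conv_weight l2 B2 v t
       \<partial>lebesgue)"

definition breve :: "real^2^2 \<Rightarrow> real^2^2" where
  "breve A = vector [vector [2 * A$1$1, A$1$2], vector [1 / A$1$2 + 2 * A$2$1, A$2$2]]"

lemma det_breve: "det A = 1 \<Longrightarrow> A$1$2 \<noteq> 0 \<Longrightarrow> det (breve A) = 1"
  by (simp add: breve_def det_2 algebra_simps)

lemma matrix_inv_2:
  fixes A :: "real^2^2"
  assumes "det A = 1"
  shows "matrix_inv A = vector [vector [A$2$2, - A$1$2], vector [- A$2$1, A$1$1]]"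
proof -
  let ?B = "vector [vector [A$2$2, - A$1$2], vector [- A$2$1, A$1$1]] :: real^2^2"
  have d: "A$1$1 * A$2$2 - A$1$2 * A$2$1 = 1"
    using assms by (simp add: det_2)
  have AB: "A ** ?B = mat 1" "?B ** A = mat 1"
    using d by (simp_all add: vec_eq_iff matrix_matrix_mult_def mat_def sum_2 forall_2 algebra_simps)
  then have "A ** matrix_inv A = mat 1 \<and> matrix_inv A ** A = mat 1"
    unfolding matrix_inv_def by (rule someI[of _ ?B, OF conjI])
  then have inv: "matrix_inv A ** A = mat 1" by blast
  have "matrix_inv A = matrix_inv A ** (A ** ?B)"
    by (simp only: AB(1) matrix_mul_rid)
  also have "\<dots> = ?B"
    by (simp only: matrix_mul_assoc inv matrix_mul_lid)
  finally show ?thesis .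
qed

end

(* On the subfield spanned by 1 and mu everything is complex analysis. Up to a chirp in each variable the
   transform is the Fourier transform rescaled by b1 and b2, and the weights of the convolution are made so that
   the chirps of the two factors recombine. What is left is the identity that the convolution of two
   Fourier transforms is (2 pi)^2 times the Fourier transform of the product. By modulation this is Parseval's
   identity, which for functions in both L1 and L2 follows by Gaussian regularisation from the continuity
   of translation. Finally nu e^(mu t) = e^(-mu t) nu
   moves nu to the right of the second kernel and accounts for the superscript (mu, -mu). *)

theory Submission
  imports Defs "HOL-Probability.Characteristic_Functions"
begin

section \<open>Continuity of translation\<close>

lemma integrable_lborel_translate_iff:
  fixes f :: "'a::euclidean_space \<Rightarrow> 'b::{banach, second_countable_topology}"
  shows "integrable lborel (\<lambda>x. f (x + t)) \<longleftrightarrow> integrable lborel f"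
proof -
  have *: "integrable lborel (\<lambda>x. f (x + t))" if f: "integrable lborel f" for f :: "'a \<Rightarrow> 'b" and t
  proof -
    have "integrable (distr lborel borel ((+) t)) f"
      using f by (simp add: lborel_distr_plus)
    then show ?thesis
      by (subst (asm) integrable_distr_eq) (use f in \<open>auto simp: add.commute\<close>)
  qed
  show ?thesis
    using *[of f t] *[of "\<lambda>x. f (x + t)" "- t"] by auto
qed

lemma integral_lborel_translate:
  fixes f :: "'a::euclidean_space \<Rightarrow> 'b::{banach, second_countable_topology}"
  shows "(\<integral>x. f (x + t) \<partial>lborel) = (\<integral>x. f x \<partial>lborel)"
proof (cases "integrable lborel f")
  case True
  have "(\<integral>x. f x \<partial>lborel) = (\<integral>x. f x \<partial>distr lborel borel ((+) t))"
    by (simp add: lborel_distr_plus)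
  also have "\<dots> = (\<integral>x. f (x + t) \<partial>lborel)"
    by (subst integral_distr) (use True in \<open>auto simp: add.commute\<close>)
  finally show ?thesis by simp
next
  case False
  then show ?thesis
    by (simp add: not_integrable_integral_eq integrable_lborel_translate_iff)
qed

definition translation_continuous ::
  "('a::euclidean_space \<Rightarrow> 'b::{banach, second_countable_topology}) \<Rightarrow> bool" where
  "translation_continuous f \<longleftrightarrow>
     (\<forall>h. h \<longlonglongrightarrow> 0 \<longrightarrow> (\<lambda>n::nat. \<integral>x. norm (f (x + h n) - f x) \<partial>lborel) \<longlonglongrightarrow> 0)"

lemma translation_continuous_approx:
  fixes f :: "'a::euclidean_space \<Rightarrow> 'b::{banach, second_countable_topology}"
  assumes f: "integrable lborel f"
    and approx: "\<And>e. e > 0 \<Longrightarrow> \<exists>g. integrable lborel g \<and> translation_continuous g \<and>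
                   (\<integral>x. norm (f x - g x) \<partial>lborel) < e"
  shows "translation_continuous f"
  unfolding translation_continuous_def
proof (intro allI impI LIMSEQ_I)
  fix h :: "nat \<Rightarrow> 'a" and e :: real
  assume h: "h \<longlonglongrightarrow> 0" and e: "0 < e"
  obtain g where g: "integrable lborel g" "translation_continuous g"
    "(\<integral>x. norm (f x - g x) \<partial>lborel) < e / 3"
    using approx[of "e / 3"] e by auto
  have "\<forall>\<^sub>F n in sequentially. (\<integral>x. norm (g (x + h n) - g x) \<partial>lborel) < e / 3"
    using g(2) h e unfolding translation_continuous_def
    by (intro order_tendstoD(2)[where y = 0]) auto
  then obtain N where N: "\<And>n. n \<ge> N \<Longrightarrow> (\<integral>x. norm (g (x + h n) - g x) \<partial>lborel) < e / 3"
    by (auto simp: eventually_sequentially)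
  have "(\<integral>x. norm (f (x + h n) - f x) \<partial>lborel) < e" if "n \<ge> N" for n
  proof -
    have fh: "integrable lborel (\<lambda>x. f (x + h n))" "integrable lborel (\<lambda>x. g (x + h n))"
      using f g(1) by (simp_all add: integrable_lborel_translate_iff)
    have "norm (f (x + h n) - f x) \<le>
            norm (f (x + h n) - g (x + h n)) + norm (g (x + h n) - g x) + norm (f x - g x)" for x
    proof -
      have "f (x + h n) - f x = f (x + h n) - g (x + h n) + (g (x + h n) - g x) + (g x - f x)"
        by simp
      then show ?thesis
        by (metis norm_triangle_le norm_triangle_ineq add_mono order_refl norm_minus_commute)
    qed
    then have "(\<integral>x. norm (f (x + h n) - f x) \<partial>lborel) \<le>
        (\<integral>x. norm (f (x + h n) - g (x + h n)) + norm (g (x + h n) - g x) + norm (f x - g x) \<partial>lborel)"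
      using f g(1) fh by (intro integral_mono) auto
    also have "\<dots> = (\<integral>x. norm (f (x + h n) - g (x + h n)) \<partial>lborel) +
        (\<integral>x. norm (g (x + h n) - g x) \<partial>lborel) + (\<integral>x. norm (f x - g x) \<partial>lborel)"
      using f g(1) fh by simp
    also have "(\<integral>x. norm (f (x + h n) - g (x + h n)) \<partial>lborel) = (\<integral>x. norm (f x - g x) \<partial>lborel)"
      by (rule integral_lborel_translate)
    finally show ?thesis using g(3) N[OF that] by simp
  qed
  then show "\<exists>no. \<forall>n\<ge>no. norm ((\<integral>x. norm (f (x + h n) - f x) \<partial>lborel) - 0) < e"
    by (intro exI[of _ N]) simp
qed

text \<open>The indicator of an open set is lower semicontinuous, so the positive part of
  \<open>I x - I (x + h n)\<close> tends to \<open>0\<close>; the negative part has the same integral.\<close>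

lemma translation_continuous_indicator_open:
  fixes U :: "'a::euclidean_space set"
  assumes U: "open U" and fin: "emeasure lborel U < \<infinity>"
  shows "translation_continuous (indicator U :: 'a \<Rightarrow> real)"
  unfolding translation_continuous_def
proof (intro allI impI)
  fix h :: "nat \<Rightarrow> 'a"
  assume h: "h \<longlonglongrightarrow> 0"
  let ?I = "indicator U :: 'a \<Rightarrow> real"
  have [measurable]: "U \<in> sets borel" using U by simp
  have I: "integrable lborel ?I" "integrable lborel (\<lambda>x. ?I (x + h n))" for n
    using fin by (simp_all add: integrable_lborel_translate_iff)
  have "norm (?I (x + h n) - ?I x) = 2 * max 0 (?I x - ?I (x + h n)) + (?I (x + h n) - ?I x)" for x n
    by (auto simp: indicator_def)
  then have "(\<integral>x. norm (?I (x + h n) - ?I x) \<partial>lborel) =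
      2 * (\<integral>x. max 0 (?I x - ?I (x + h n)) \<partial>lborel)" for n
    using I by (simp add: integral_lborel_translate)
  moreover have "(\<lambda>n. \<integral>x. max 0 (?I x - ?I (x + h n)) \<partial>lborel) \<longlonglongrightarrow> integral\<^sup>L lborel (\<lambda>x::'a. 0::real)"
  proof (rule integral_dominated_convergence[where w = ?I])
    show "AE x in lborel. (\<lambda>n. max 0 (?I x - ?I (x + h n))) \<longlonglongrightarrow> 0"
    proof (rule AE_I2)
      fix x :: 'a
      show "(\<lambda>n. max 0 (?I x - ?I (x + h n))) \<longlonglongrightarrow> 0"
      proof (cases "x \<in> U")
        case True
        have "(\<lambda>n. x + h n) \<longlonglongrightarrow> x + 0" by (intro tendsto_intros h)
        then have "\<forall>\<^sub>F n in sequentially. x + h n \<in> U"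
          using U True by (intro topological_tendstoD[of _ x]) auto
        then show ?thesis
          by (intro tendsto_eventually) (auto elim!: eventually_mono simp: indicator_def)
      qed simp
    qed
  qed (use I in \<open>auto simp: indicator_def\<close>)
  ultimately show "(\<lambda>n. \<integral>x. norm (?I (x + h n) - ?I x) \<partial>lborel) \<longlonglongrightarrow> 0"
    using tendsto_mult_left[of _ 0 sequentially 2] by simp
qed

lemma translation_continuous_indicator:
  fixes A :: "'a::euclidean_space set"
  assumes A: "A \<in> sets lborel" and fin: "emeasure lborel A < \<infinity>"
  shows "translation_continuous (indicator A :: 'a \<Rightarrow> real)"
proof (rule translation_continuous_approx)
  show "integrable lborel (indicator A :: 'a \<Rightarrow> real)"
    using A fin by simp
  fix e :: real
  assume e: "e > 0"
  have "A \<in> sets lebesgue" using A by simp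
  then obtain T where T: "open T" "A \<subseteq> T" "T - A \<in> lmeasurable" "emeasure lebesgue (T - A) < ennreal e"
    using e by (rule sets_lebesgue_outer_open)
  have [measurable]: "A \<in> sets borel" "T \<in> sets borel" using A T(1) by auto
  have TA: "emeasure lborel (T - A) < ennreal e" using T(4) by simp
  have "emeasure lborel T = emeasure lborel A + emeasure lborel (T - A)"
    using T(2) by (subst plus_emeasure) (auto simp: Un_absorb1)
  also have "\<dots> < \<infinity>" using fin TA by (simp add: less_top[symmetric]) auto
  finally have Tfin: "emeasure lborel T < \<infinity>" .
  have "(\<integral>x. norm (indicator A x - indicator T x :: real) \<partial>lborel) = (\<integral>x. indicator (T - A) x \<partial>lborel)"
    using T(2) by (intro Bochner_Integration.integral_cong) (auto simp: indicator_def)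
  also have "\<dots> < e"
    using TA e by (simp add: measure_def) (metis enn2real_less_iff ennreal_less_top order_less_trans)
  finally show "\<exists>g. integrable lborel g \<and> translation_continuous g \<and>
      (\<integral>x. norm (indicator A x - g x :: real) \<partial>lborel) < e"
    using translation_continuous_indicator_open[OF T(1) Tfin] Tfin
    by (intro exI[of _ "indicator T"]) auto
qed

lemma integrable_translation_continuous:
  fixes f :: "'a::euclidean_space \<Rightarrow> 'b::{banach, second_countable_topology}"
  assumes "integrable lborel f"
  shows "translation_continuous f"
  using assms
proof (induction rule: integrable_induct)
  case (base A c)
  have "norm (indicator A (x + h) *\<^sub>R c - indicator A x *\<^sub>R c) =
      norm (indicator A (x + h) - indicator A x :: real) * norm c" for x h :: 'a
    by (simp flip: scaleR_left_diff_distrib)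
  then show ?case
    using translation_continuous_indicator[OF base]
    unfolding translation_continuous_def by (auto intro!: tendsto_mult_left_zero)
next
  case (add f g)
  show ?case
    unfolding translation_continuous_def
  proof (intro allI impI)
    fix h :: "nat \<Rightarrow> 'a"
    assume h: "h \<longlonglongrightarrow> 0"
    have I: "integrable lborel (\<lambda>x. f (x + h n))" "integrable lborel (\<lambda>x. g (x + h n))" for n
      using add.hyps by (simp_all add: integrable_lborel_translate_iff)
    have "(\<integral>x. norm (f (x + h n) + g (x + h n) - (f x + g x)) \<partial>lborel) \<le>
        (\<integral>x. norm (f (x + h n) - f x) + norm (g (x + h n) - g x) \<partial>lborel)" for n
      using add.hyps I by (intro integral_mono) (auto simp: norm_diff_triangle_ineq)
    also have "\<dots> n = (\<integral>x. norm (f (x + h n) - f x) \<partial>lborel) + (\<integral>x. norm (g (x + h n) - g x) \<partial>lborel)" for n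
      using add.hyps I by simp
    finally have le: "(\<integral>x. norm (f (x + h n) + g (x + h n) - (f x + g x)) \<partial>lborel) \<le> 
       (\<integral>x. norm (f (x + h n) - f x) \<partial>lborel) + (\<integral>x. norm (g (x + h n) - g x) \<partial>lborel)" for n .
    have "(\<lambda>n. (\<integral>x. norm (f (x + h n) - f x) \<partial>lborel) + (\<integral>x. norm (g (x + h n) - g x) \<partial>lborel)) \<longlonglongrightarrow> 0 + 0"
      using add.IH h unfolding translation_continuous_def by (intro tendsto_add) auto
    then show "(\<lambda>n. \<integral>x. norm (f (x + h n) + g (x + h n) - (f x + g x)) \<partial>lborel) \<longlonglongrightarrow> 0"
      by (rule Lim_null_comparison[rotated, OF tendsto_eq_rhs])
        (use le in \<open>auto intro!: always_eventually\<close>)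
  qed
next
  case (lim f s)
  show ?case
  proof (rule translation_continuous_approx)
    fix e :: real
    assume e: "e > 0"
    have [measurable]: "f \<in> borel_measurable borel" "s i \<in> borel_measurable borel" for i
      using lim.hyps(1)[of i] lim.hyps(4) by auto
    have "(\<lambda>i. \<integral>x. norm (f x - s i x) \<partial>lborel) \<longlonglongrightarrow> integral\<^sup>L lborel (\<lambda>x::'a. 0::real)"
    proof (rule integral_dominated_convergence[where w = "\<lambda>x. 3 * norm (f x)"])
      show "AE x in lborel. (\<lambda>i. norm (f x - s i x)) \<longlonglongrightarrow> 0"
      proof (rule AE_I2)
        fix x
        have "(\<lambda>i. norm (f x - s i x)) \<longlonglongrightarrow> norm (f x - f x)"
          using lim.hyps(2)[of x] by (intro tendsto_intros) auto
        then show "(\<lambda>i. norm (f x - s i x)) \<longlonglongrightarrow> 0" by simp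
      qed
      show "AE x in lborel. norm (norm (f x - s i x)) \<le> 3 * norm (f x)" for i
      proof (rule AE_I2)
        fix x
        show "norm (norm (f x - s i x)) \<le> 3 * norm (f x)"
          using lim.hyps(3)[of x i] norm_triangle_ineq4[of "f x" "s i x"] by simp
      qed
    qed (use lim.hyps in auto)
    then have "\<forall>\<^sub>F i in sequentially. (\<integral>x. norm (f x - s i x) \<partial>lborel) < e"
      using e by (intro order_tendstoD(2)[where y = 0]) auto
    then obtain i where "(\<integral>x. norm (f x - s i x) \<partial>lborel) < e"
      by (auto simp: eventually_sequentially)
    then show "\<exists>g. integrable lborel g \<and> translation_continuous g \<and> (\<integral>x. norm (f x - g x) \<partial>lborel) < e"
      using lim.hyps(1) lim.IH by blast
  qed (rule lim.hyps)
qed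

lemma lborel_affine_integrable_iff:
  fixes f :: "'a::euclidean_space \<Rightarrow> 'b::{banach, second_countable_topology}"
  assumes c: "c \<noteq> 0"
  shows "integrable lborel (\<lambda>x. f (t + c *\<^sub>R x)) \<longleftrightarrow> integrable lborel f"
proof -
  have *: "integrable lborel (\<lambda>x. f (t + c *\<^sub>R x))" if f: "integrable lborel f" and c: "c \<noteq> 0"
    for f :: "'a \<Rightarrow> 'b" and t c
  proof -
    have [measurable]: "f \<in> borel_measurable borel" using f by auto
    have "integrable (density (distr lborel borel (\<lambda>x. t + c *\<^sub>R x)) (\<lambda>_. ennreal (\<bar>c\<bar> ^ DIM('a)))) f"
      using f lborel_affine[OF c, of t] by (simp add: ennreal_power)
    then have "integrable (distr lborel borel (\<lambda>x. t + c *\<^sub>R x)) (\<lambda>x. (\<bar>c\<bar> ^ DIM('a)) *\<^sub>R f x)"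
      by (subst (asm) integrable_density) auto
    from integrable_scaleR_right[of "1 / \<bar>c\<bar> ^ DIM('a)", OF this]
    have "integrable (distr lborel borel (\<lambda>x. t + c *\<^sub>R x)) f"
      using c by simp
    then show ?thesis
      by (subst (asm) integrable_distr_eq) auto
  qed
  show ?thesis
    using *[of f c t] *[of "\<lambda>x. f (t + c *\<^sub>R x)" "1 / c" "- t /\<^sub>R c"] c
    by (auto simp: scaleR_diff_right)
qed

lemma lborel_affine_integral:
  fixes f :: "'a::euclidean_space \<Rightarrow> 'b::{banach, second_countable_topology}"
  assumes c: "c \<noteq> 0"
  shows "(\<integral>x. f x \<partial>lborel) = \<bar>c\<bar> ^ DIM('a) *\<^sub>R (\<integral>x. f (t + c *\<^sub>R x) \<partial>lborel)"
proof (cases "integrable lborel f")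
  case True
  then have [measurable]: "f \<in> borel_measurable borel" by auto
  have "(\<integral>x. f x \<partial>lborel) =
      (\<integral>x. f x \<partial>density (distr lborel borel (\<lambda>x. t + c *\<^sub>R x)) (\<lambda>_. ennreal (\<bar>c\<bar> ^ DIM('a))))"
    using lborel_affine[OF c, of t] by (simp add: ennreal_power)
  also have "\<dots> = (\<integral>x. (\<bar>c\<bar> ^ DIM('a)) *\<^sub>R f x \<partial>distr lborel borel (\<lambda>x. t + c *\<^sub>R x))"
    by (subst integral_density) auto
  also have "\<dots> = (\<integral>x. (\<bar>c\<bar> ^ DIM('a)) *\<^sub>R f (t + c *\<^sub>R x) \<partial>lborel)"
    by (subst integral_distr) auto
  finally show ?thesis by simp
next
  case False
  then show ?thesis
    using lborel_affine_integrable_iff[OF c, of f t] by (simp add: not_integrable_integral_eq)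
qed

lemma mult_le_half_sum_squares: "a * b \<le> (a\<^sup>2 + b\<^sup>2) / 2" for a b :: real
  using sum_squares_bound[of a b] by simp

lemma integrable_mult_square_integrable:
  fixes f g :: "'a \<Rightarrow> complex"
  assumes [measurable]: "f \<in> borel_measurable M" "g \<in> borel_measurable M"
    and f: "integrable M (\<lambda>x. (norm (f x))\<^sup>2)" and g: "integrable M (\<lambda>x. (norm (g x))\<^sup>2)"
  shows "integrable M (\<lambda>x. f x * g x)"
    and "(\<integral>x. norm (f x * g x) \<partial>M) \<le> ((\<integral>x. (norm (f x))\<^sup>2 \<partial>M) + (\<integral>x. (norm (g x))\<^sup>2 \<partial>M)) / 2"
proof -
  have le: "norm (f x * g x) \<le> ((norm (f x))\<^sup>2 + (norm (g x))\<^sup>2) / 2" for x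
    using mult_le_half_sum_squares[of "norm (f x)" "norm (g x)"] by (simp add: norm_mult)
  have I: "integrable M (\<lambda>x. ((norm (f x))\<^sup>2 + (norm (g x))\<^sup>2) / 2)"
    using f g by simp
  show int: "integrable M (\<lambda>x. f x * g x)"
    by (rule Bochner_Integration.integrable_bound[OF I]) (use le in auto)
  have "(\<integral>x. norm (f x * g x) \<partial>M) \<le> (\<integral>x. ((norm (f x))\<^sup>2 + (norm (g x))\<^sup>2) / 2 \<partial>M)"
    by (intro integral_mono int integrable_norm I le)
  also have "\<dots> = ((\<integral>x. (norm (f x))\<^sup>2 \<partial>M) + (\<integral>x. (norm (g x))\<^sup>2 \<partial>M)) / 2"
    using f g by simp
  finally show "(\<integral>x. norm (f x * g x) \<partial>M) \<le>
    ((\<integral>x. (norm (f x))\<^sup>2 \<partial>M) + (\<integral>x. (norm (g x))\<^sup>2 \<partial>M)) / 2" .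
qed

lemma square_integrable_truncation:
  fixes f :: "'a \<Rightarrow> complex"
  assumes [measurable]: "f \<in> borel_measurable M" and f: "integrable M (\<lambda>x. (norm (f x))\<^sup>2)"
    and e: "e > 0"
  obtains n :: nat where "(\<integral>x. (if norm (f x) \<le> real n then 0 else (norm (f x))\<^sup>2) \<partial>M) < e"
proof -
  have "(\<lambda>n. \<integral>x. (if norm (f x) \<le> real n then 0 else (norm (f x))\<^sup>2) \<partial>M)
      \<longlonglongrightarrow> (\<integral>x. 0 \<partial>M)"
  proof (rule integral_dominated_convergence[OF _ _ f])
    show "AE x in M. (\<lambda>n. if norm (f x) \<le> real n then 0 else (norm (f x))\<^sup>2) \<longlonglongrightarrow> 0"
    proof (rule AE_I2)
      fix x
      obtain N :: nat where "norm (f x) \<le> real N"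
        using real_arch_simple by blast
      then have "\<forall>\<^sub>F n in sequentially. norm (f x) \<le> real n"
        unfolding eventually_sequentially by (intro exI[of _ N]) auto
      then show "(\<lambda>n. if norm (f x) \<le> real n then 0 else (norm (f x))\<^sup>2) \<longlonglongrightarrow> 0"
        by (intro tendsto_eventually) (erule eventually_mono, simp)
    qed
  qed auto
  then have "\<forall>\<^sub>F n in sequentially. (\<integral>x. (if norm (f x) \<le> real n then 0 else (norm (f x))\<^sup>2) \<partial>M) < e"
    using e by (intro order_tendstoD(2)[where y = 0]) auto
  then show ?thesis
    using that by (auto simp: eventually_sequentially)
qed

text \<open>Where \<open>f\<close> is bounded, continuity of translation in \<open>L\<^sup>1\<close> suffices; where \<open>f\<close> is large,
  \<open>norm f * norm d \<le> (norm f)\<^sup>2 / c + c * (norm d)\<^sup>2\<close> with \<open>c\<close> small.\<close>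

lemma tendsto_integral_translate_mult:
  fixes f g :: "'a::euclidean_space \<Rightarrow> complex"
  assumes f[measurable]: "f \<in> borel_measurable borel" and g1: "integrable lborel g"
    and f2: "integrable lborel (\<lambda>x. (norm (f x))\<^sup>2)" and g2: "integrable lborel (\<lambda>x. (norm (g x))\<^sup>2)"
    and h: "h \<longlonglongrightarrow> 0"
  shows "(\<lambda>n. \<integral>x. f x * g (x + h n) \<partial>lborel) \<longlonglongrightarrow> (\<integral>x. f x * g x \<partial>lborel)"
proof (rule LIMSEQ_I)
  fix e :: real
  assume e: "0 < e"
  have [measurable]: "g \<in> borel_measurable borel" using g1 by auto
  define S where "S = (\<integral>x. (norm (g x))\<^sup>2 \<partial>lborel)"
  define c where "c = e / (12 * (S + 1))"
  have S: "S \<ge> 0" by (simp add: S_def)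
  have c: "c > 0" "4 * c * S < e / 3"
    using e S by (auto simp: c_def divide_simps)
  define r where "r n x = (if norm (f x) \<le> real n then 0 else (norm (f x))\<^sup>2)" for n x
  obtain m where m: "(\<integral>x. r m x \<partial>lborel) < e * c / 3"
    using square_integrable_truncation[of f lborel "e * c / 3"] f2 e c unfolding r_def by auto
  have r: "integrable lborel (r m)"
    unfolding r_def by (rule Bochner_Integration.integrable_bound[OF f2]) auto
  define D where "D n = (\<integral>x. norm (g (x + h n) - g x) \<partial>lborel)" for n
  have "D \<longlonglongrightarrow> 0"
    using integrable_translation_continuous[OF g1] h
    unfolding translation_continuous_def D_def by auto
  then have "(\<lambda>n. real m * D n) \<longlonglongrightarrow> real m * 0"
    by (intro tendsto_intros)
  then have "\<forall>\<^sub>F n in sequentially. real m * D n < e / 3"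
    using e by (intro order_tendstoD(2)[where y = 0]) auto
  then obtain N where N: "\<And>n. n \<ge> N \<Longrightarrow> real m * D n < e / 3"
    by (auto simp: eventually_sequentially)
  have "norm ((\<integral>x. f x * g (x + h n) \<partial>lborel) - (\<integral>x. f x * g x \<partial>lborel)) < e" if n: "n \<ge> N" for n
  proof -
    have gh: "integrable lborel (\<lambda>x. g (x + h n))" "integrable lborel (\<lambda>x. (norm (g (x + h n)))\<^sup>2)"
      using g1 g2 integrable_lborel_translate_iff[of "\<lambda>x. (norm (g x))\<^sup>2"]
      by (simp_all add: integrable_lborel_translate_iff)
    have fg: "integrable lborel (\<lambda>x. f x * g x)" "integrable lborel (\<lambda>x. f x * g (x + h n))"
      using f2 g2 gh by (auto intro!: integrable_mult_square_integrable)
    define w where "w x = real m * norm (g (x + h n) - g x) + r m x / c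
        + 2 * c * ((norm (g (x + h n)))\<^sup>2 + (norm (g x))\<^sup>2)" for x
    have w: "integrable lborel w"
      unfolding w_def using r g1 gh g2 by auto
    have le: "norm (f x * g (x + h n) - f x * g x) \<le> w x" for x
    proof -
      let ?d = "norm (g (x + h n) - g x)" and ?F = "norm (f x)"
      have d2: "?d\<^sup>2 \<le> 2 * ((norm (g (x + h n)))\<^sup>2 + (norm (g x))\<^sup>2)"
      proof -
        have "?d\<^sup>2 \<le> (norm (g (x + h n)) + norm (g x))\<^sup>2"
          by (intro power_mono norm_triangle_ineq4) auto
        also have "\<dots> \<le> 2 * ((norm (g (x + h n)))\<^sup>2 + (norm (g x))\<^sup>2)"
          using sum_squares_bound[of "norm (g (x + h n))" "norm (g x)"] by (simp add: power2_sum)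
        finally show ?thesis .
      qed
      have "?F * ?d \<le> real m * ?d + r m x / c + c * ?d\<^sup>2"
      proof (cases "?F \<le> real m")
        case True
        then have "?F * ?d \<le> real m * ?d" by (intro mult_right_mono) auto
        then show ?thesis using True c by (simp add: r_def add_increasing2)
      next
        case False
        have "0 \<le> (?F - c * ?d)\<^sup>2 + ?F\<^sup>2 + (c * ?d)\<^sup>2" by simp
        then have "c * (?F * ?d) \<le> ?F\<^sup>2 + c\<^sup>2 * ?d\<^sup>2"
          by (simp add: power2_diff power_mult_distrib algebra_simps)
        also have "\<dots> = c * (?F\<^sup>2 / c + c * ?d\<^sup>2)"
          using c by (simp add: field_simps power2_eq_square)
        finally have "?F * ?d \<le> ?F\<^sup>2 / c + c * ?d\<^sup>2"
          using c by (simp only: mult_le_cancel_left_pos)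
        moreover have "r m x / c = ?F\<^sup>2 / c" using False by (simp add: r_def)
        moreover have "0 \<le> real m * ?d" by simp
        ultimately show ?thesis by linarith
      qed
      also have "c * ?d\<^sup>2 \<le> c * (2 * ((norm (g (x + h n)))\<^sup>2 + (norm (g x))\<^sup>2))"
        using d2 c by (intro mult_left_mono) auto
      finally have "?F * ?d \<le> w x" by (simp add: w_def algebra_simps)
      then show ?thesis by (simp flip: right_diff_distrib add: norm_mult)
    qed
    have "norm ((\<integral>x. f x * g (x + h n) \<partial>lborel) - (\<integral>x. f x * g x \<partial>lborel)) =
        norm (\<integral>x. f x * g (x + h n) - f x * g x \<partial>lborel)"
      using fg by simp
    also have "\<dots> \<le> (\<integral>x. w x \<partial>lborel)"
      by (intro Bochner_Integration.integral_norm_bound_integral[OF _ w] le) (use fg in auto)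
    also have "\<dots> = real m * D n + (\<integral>x. r m x \<partial>lborel) / c
        + 2 * c * ((\<integral>x. (norm (g (x + h n)))\<^sup>2 \<partial>lborel) + S)"
      unfolding w_def D_def S_def using r g1 gh g2 by simp
    also have "(\<integral>x. (norm (g (x + h n)))\<^sup>2 \<partial>lborel) = S"
      unfolding S_def by (rule integral_lborel_translate)
    also have "real m * D n + (\<integral>x. r m x \<partial>lborel) / c + 2 * c * (S + S) < e / 3 + e / 3 + e / 3"
    proof (intro add_strict_mono N n)
      show "(\<integral>x. r m x \<partial>lborel) / c < e / 3" using m c by (simp add: field_simps)
      show "2 * c * (S + S) < e / 3" using c(2) by (simp add: algebra_simps)
    qed
    finally show ?thesis by simp
  qed
  then show "\<exists>no. \<forall>n\<ge>no. norm ((\<integral>x. f x * g (x + h n) \<partial>lborel) - (\<integral>x. f x * g x \<partial>lborel)) < e"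
    by blast
qed

section \<open>Plancherel and Parseval identities\<close>

lemma borel_measurable_cis [measurable]: "cis \<in> borel_measurable borel"
  by (intro borel_measurable_continuous_onI continuous_intros)

lemma
  fixes f :: "'a::euclidean_space \<Rightarrow> complex" and g :: "'b::euclidean_space \<Rightarrow> complex"
  assumes f: "integrable lborel f" and g: "integrable lborel g"
  shows integrable_mult_fst_snd: "integrable lborel (\<lambda>z. f (fst z) * g (snd z))"
    and integral_mult_fst_snd:
      "(\<integral>z. f (fst z) * g (snd z) \<partial>lborel) = (\<integral>x. f x \<partial>lborel) * (\<integral>y. g y \<partial>lborel)"
proof -
  have [measurable]: "f \<in> borel_measurable borel" "g \<in> borel_measurable borel"
    using f g by auto
  have I: "integrable (lborel \<Otimes>\<^sub>M lborel) (\<lambda>z. f (fst z) * g (snd z))"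
    by (rule lborel_pair.Fubini_integrable) (use f g in \<open>auto simp: norm_mult\<close>)
  then show "integrable lborel (\<lambda>z. f (fst z) * g (snd z))"
    by (simp add: lborel_prod)
  show "(\<integral>z. f (fst z) * g (snd z) \<partial>lborel) = (\<integral>x. f x \<partial>lborel) * (\<integral>y. g y \<partial>lborel)"
    using lborel_pair.integral_fst'[OF I] by (simp add: lborel_prod)
qed

lemma integrable_cis_mult:
  fixes f :: "'a \<Rightarrow> complex"
  assumes f: "integrable M f" and [measurable]: "p \<in> borel_measurable M"
  shows "integrable M (\<lambda>x. cis (p x) * f x)"
proof -
  have [measurable]: "f \<in> borel_measurable M" using f by auto
  show ?thesis
    by (rule Bochner_Integration.integrable_bound[OF f]) (auto simp: norm_mult)
qed

definition fourier :: "('a::euclidean_space \<Rightarrow> complex) \<Rightarrow> 'a \<Rightarrow> complex" where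
  "fourier f w = (\<integral>x. cis (- (x \<bullet> w)) * f x \<partial>lborel)"

lemma borel_measurable_fourier [measurable]:
  fixes f :: "'a::euclidean_space \<Rightarrow> complex"
  assumes [measurable]: "f \<in> borel_measurable borel"
  shows "fourier f \<in> borel_measurable borel"
  unfolding fourier_def by measurable

lemma norm_fourier_le: "norm (fourier f w) \<le> (\<integral>x. norm (f x) \<partial>lborel)"
  unfolding fourier_def by (rule order_trans[OF integral_norm_bound]) (simp add: norm_mult)

lemma fourier_cnj: "fourier (\<lambda>x. cnj (f x)) (- w) = cnj (fourier f w)"
  unfolding fourier_def Bochner_Integration.integral_cnj[symmetric] by (simp add: cis_cnj)

lemma fourier_modulate: "fourier (\<lambda>x. cis (- (x \<bullet> s)) * f x) w = fourier f (w + s)"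
  unfolding fourier_def by (simp add: mult.assoc[symmetric] cis_mult inner_add_right)

lemma
  shows integrable_std_normal_density: "integrable lborel std_normal_density"
    and fourier_std_normal_density:
      "fourier std_normal_density t = of_real (sqrt (2 * pi) * std_normal_density t)"
proof -
  show I: "integrable lborel std_normal_density"
    using integrable_std_normal_moment[of 0] by simp
  have "fourier std_normal_density t = char std_normal_distribution (- t)"
    unfolding char_def fourier_def
    by (subst integral_density) (auto simp: cis_conv_exp scaleR_conv_of_real mult_ac)
  also have "\<dots> = of_real (exp (- t\<^sup>2 / 2))"
    by (simp add: char_std_normal_distribution)
  also have "exp (- t\<^sup>2 / 2) = sqrt (2 * pi) * std_normal_density t"
    by (simp add: std_normal_density_def)
  finally show "fourier std_normal_density t = of_real (sqrt (2 * pi) * std_normal_density t)" .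
qed

definition gauss2 :: "real \<times> real \<Rightarrow> real" where
  "gauss2 z = std_normal_density (fst z) * std_normal_density (snd z)"

lemma isCont_gauss2: "isCont gauss2 z"
  unfolding gauss2_def std_normal_density_def by (intro continuous_intros) auto

lemma borel_measurable_gauss2 [measurable]: "gauss2 \<in> borel_measurable borel"
  by (intro borel_measurable_continuous_onI continuous_at_imp_continuous_on ballI isCont_gauss2)

lemma gauss2_nonneg: "0 \<le> gauss2 z"
  by (simp add: gauss2_def)

lemma gauss2_0: "gauss2 0 = 1 / (2 * pi)"
  by (simp add: gauss2_def std_normal_density_def)

lemma gauss2_le: "gauss2 z \<le> 1 / (2 * pi)"
proof -
  have "gauss2 z = 1 / (2 * pi) * (exp (- (fst z)\<^sup>2 / 2) * exp (- (snd z)\<^sup>2 / 2))"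
    by (simp add: gauss2_def std_normal_density_def)
  also have "\<dots> \<le> 1 / (2 * pi) * (1 * 1)"
    by (intro mult_left_mono mult_mono) auto
  finally show ?thesis by simp
qed

lemma
  shows integrable_gauss2: "integrable lborel gauss2"
    and integral_gauss2: "(\<integral>z. gauss2 z \<partial>lborel) = 1"
    and fourier_gauss2: "fourier gauss2 w = of_real (2 * pi * gauss2 w)"
proof -
  let ?n = "\<lambda>x. complex_of_real (std_normal_density x)"
  have I: "integrable lborel ?n"
    using integrable_std_normal_density by simp
  have g: "complex_of_real (gauss2 z) = ?n (fst z) * ?n (snd z)" for z
    by (simp add: gauss2_def)
  have "integrable lborel (\<lambda>z. complex_of_real (gauss2 z))"
    unfolding g by (rule integrable_mult_fst_snd[OF I I])
  from integrable_Re[OF this] show G: "integrable lborel gauss2" by simp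
  have F: "fourier gauss2 w = of_real (2 * pi * gauss2 w)" for w
  proof -
    have c: "cis (- (z \<bullet> w)) = cis (- (fst z * fst w)) * cis (- (snd z * snd w))" for z
      by (simp add: inner_prod_def cis_mult)
    have "fourier gauss2 w = (\<integral>z. (cis (- (fst z * fst w)) * ?n (fst z)) * (cis (- (snd z * snd w)) * ?n (snd z)) \<partial>lborel)"
      unfolding fourier_def g c by (simp add: mult_ac)
    also have "\<dots> = fourier ?n (fst w) * fourier ?n (snd w)"
      unfolding fourier_def inner_real_def
      by (rule integral_mult_fst_snd) (auto intro!: integrable_cis_mult I)
    also have "\<dots> = complex_of_real (sqrt (2 * pi) * sqrt (2 * pi) * gauss2 w)"
      by (simp add: fourier_std_normal_density gauss2_def del: real_sqrt_mult_self)
    finally show ?thesis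
      by simp
  qed
  then show "fourier gauss2 w = of_real (2 * pi * gauss2 w)" .
  have "(\<integral>z. complex_of_real (gauss2 z) \<partial>lborel) = fourier gauss2 0"
    by (simp add: fourier_def)
  also have "\<dots> = 1" unfolding F gauss2_0 by simp
  finally show "(\<integral>z. gauss2 z \<partial>lborel) = 1"
    by (metis integral_complex_of_real of_real_eq_1_iff)
qed

lemma integral_cis_gauss2_scaled:
  assumes d: "d > 0"
  shows "(\<integral>w. cis (- (x \<bullet> w)) * gauss2 (d *\<^sub>R w) \<partial>lborel) = of_real (2 * pi / d\<^sup>2 * gauss2 (x /\<^sub>R d))"
proof -
  have "fourier gauss2 (x /\<^sub>R d) = \<bar>d\<bar> ^ DIM(real \<times> real) *\<^sub>R
      (\<integral>w. cis (- ((0 + d *\<^sub>R w) \<bullet> (x /\<^sub>R d))) * gauss2 (0 + d *\<^sub>R w) \<partial>lborel)"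
    unfolding fourier_def by (rule lborel_affine_integral) (use d in simp)
  also have "\<dots> = d\<^sup>2 *\<^sub>R (\<integral>w. cis (- (x \<bullet> w)) * gauss2 (d *\<^sub>R w) \<partial>lborel)"
  proof -
    have "(0 + d *\<^sub>R w) \<bullet> (x /\<^sub>R d) = x \<bullet> w" for w
      using d by (simp add: inner_commute mult.assoc[symmetric])
    then show ?thesis
      by (simp add: power2_eq_square)
  qed
  finally show ?thesis
    using d by (simp add: fourier_gauss2 scaleR_conv_of_real field_simps)
qed

lemma integrable_translate_mult:
  fixes f g :: "'a::euclidean_space \<Rightarrow> complex"
  assumes [measurable]: "f \<in> borel_measurable borel" "g \<in> borel_measurable borel"
    and f2: "integrable lborel (\<lambda>x. (norm (f x))\<^sup>2)" and g2: "integrable lborel (\<lambda>x. (norm (g x))\<^sup>2)"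
  shows "integrable lborel (\<lambda>x. f x * g (x + h))"
    and "(\<integral>x. norm (f x * g (x + h)) \<partial>lborel) \<le>
      ((\<integral>x. (norm (f x))\<^sup>2 \<partial>lborel) + (\<integral>x. (norm (g x))\<^sup>2 \<partial>lborel)) / 2"
proof -
  have "integrable lborel (\<lambda>x. (norm (g (x + h)))\<^sup>2)"
    using g2 integrable_lborel_translate_iff[of "\<lambda>x. (norm (g x))\<^sup>2"] by blast
  note * = integrable_mult_square_integrable[OF _ _ f2 this]
  show "integrable lborel (\<lambda>x. f x * g (x + h))"
    by (rule *) auto
  have "(\<integral>x. norm (f x * g (x + h)) \<partial>lborel) \<le>
      ((\<integral>x. (norm (f x))\<^sup>2 \<partial>lborel) + (\<integral>x. (norm (g (x + h)))\<^sup>2 \<partial>lborel)) / 2"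
    by (rule *) auto
  then show "(\<integral>x. norm (f x * g (x + h)) \<partial>lborel) \<le>
      ((\<integral>x. (norm (f x))\<^sup>2 \<partial>lborel) + (\<integral>x. (norm (g x))\<^sup>2 \<partial>lborel)) / 2"
    using integral_lborel_translate[of "\<lambda>x. (norm (g x))\<^sup>2" h] by simp
qed

lemma fourier_mult_gauss2:
  fixes f g :: "real \<times> real \<Rightarrow> complex"
  assumes f1: "integrable lborel f" and g1: "integrable lborel g"
    and f2: "integrable lborel (\<lambda>x. (norm (f x))\<^sup>2)" and g2: "integrable lborel (\<lambda>x. (norm (g x))\<^sup>2)"
    and d: "d > 0"
  shows "(\<integral>w. fourier f w * fourier g (- w) * gauss2 (d *\<^sub>R w) \<partial>lborel) =
     2 * pi * (\<integral>z. gauss2 z * (\<integral>x. f x * g (x + (- d) *\<^sub>R z) \<partial>lborel) \<partial>lborel)"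
proof -
  have [measurable]: "f \<in> borel_measurable borel" "g \<in> borel_measurable borel"
    using f1 g1 by auto
  define H where "H w p = cis (- ((fst p - snd p) \<bullet> w)) * (complex_of_real (gauss2 (d *\<^sub>R w)) * (f (fst p) * g (snd p)))"
    for w :: "real \<times> real" and p :: "(real \<times> real) \<times> (real \<times> real)"
  have fg: "integrable lborel (\<lambda>p. f (fst p) * g (snd p))"
    by (rule integrable_mult_fst_snd[OF f1 g1])
  have "integrable lborel (\<lambda>w. gauss2 (0 + d *\<^sub>R w))"
    using integrable_gauss2 d by (subst lborel_affine_integrable_iff) auto
  then have G: "integrable lborel (\<lambda>w. complex_of_real (gauss2 (d *\<^sub>R w)))" by simp
  have H: "integrable (lborel \<Otimes>\<^sub>M lborel) (case_prod H)"
  proof -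
    have "integrable (lborel \<Otimes>\<^sub>M lborel)
        (\<lambda>q. complex_of_real (gauss2 (d *\<^sub>R fst q)) * (f (fst (snd q)) * g (snd (snd q))))"
      using integrable_mult_fst_snd[OF G fg] by (simp add: lborel_prod)
    then have "integrable (lborel \<Otimes>\<^sub>M lborel) (\<lambda>q. cis (- ((fst (snd q) - snd (snd q)) \<bullet> fst q)) *
        (complex_of_real (gauss2 (d *\<^sub>R fst q)) * (f (fst (snd q)) * g (snd (snd q)))))"
      by (rule integrable_cis_mult)
        (simp add: lborel_prod, intro borel_measurable_continuous_onI continuous_intros)
    then show ?thesis by (simp add: H_def case_prod_unfold)
  qed
  have prod: "fourier f w * fourier g (- w) * gauss2 (d *\<^sub>R w) = (\<integral>p. H w p \<partial>lborel)" for w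
  proof -
    have "fourier f w * fourier g (- w) =
        (\<integral>p. (cis (- (fst p \<bullet> w)) * f (fst p)) * (cis (- (snd p \<bullet> - w)) * g (snd p)) \<partial>lborel)"
      unfolding fourier_def
      by (rule integral_mult_fst_snd[symmetric]) (auto intro!: integrable_cis_mult f1 g1)
    also have "\<dots> * gauss2 (d *\<^sub>R w) = (\<integral>p. (cis (- (fst p \<bullet> w)) * f (fst p)) *
        (cis (- (snd p \<bullet> - w)) * g (snd p)) * gauss2 (d *\<^sub>R w) \<partial>lborel)"
      by simp
    also have "\<dots> = (\<integral>p. H w p \<partial>lborel)"
      unfolding H_def
    proof (intro Bochner_Integration.integral_cong refl)
      fix p :: "(real \<times> real) \<times> (real \<times> real)"
      have "cis (- ((fst p - snd p) \<bullet> w)) = cis (- (fst p \<bullet> w)) * cis (- (snd p \<bullet> - w))"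
        by (simp add: cis_mult inner_diff_left)
      then show "(cis (- (fst p \<bullet> w)) * f (fst p)) * (cis (- (snd p \<bullet> - w)) * g (snd p)) * gauss2 (d *\<^sub>R w) =
        cis (- ((fst p - snd p) \<bullet> w)) * (complex_of_real (gauss2 (d *\<^sub>R w)) * (f (fst p) * g (snd p)))"
        by (simp only: mult_ac)
    qed
    finally show ?thesis .
  qed
  define K where "K z = complex_of_real (2 * pi / d\<^sup>2 * gauss2 (z /\<^sub>R d))" for z
  have inner: "(\<integral>w. H w p \<partial>lborel) = f (fst p) * (g (snd p) * K (fst p - snd p))" for p
  proof -
    have "H w p = (cis (- ((fst p - snd p) \<bullet> w)) * gauss2 (d *\<^sub>R w)) * (f (fst p) * g (snd p))" for w
      by (simp add: H_def)
    then have "(\<integral>w. H w p \<partial>lborel) =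
        (\<integral>w. cis (- ((fst p - snd p) \<bullet> w)) * gauss2 (d *\<^sub>R w) \<partial>lborel) * (f (fst p) * g (snd p))"
      by (simp only: integral_mult_left_zero)
    also have "\<dots> = K (fst p - snd p) * (f (fst p) * g (snd p))"
      by (simp only: integral_cis_gauss2_scaled[OF d] K_def)
    finally show ?thesis
      by (simp only: mult_ac)
  qed
  have I: "integrable (lborel \<Otimes>\<^sub>M lborel) (\<lambda>p. f (fst p) * (g (snd p) * K (fst p - snd p)))"
    using lborel_pair.integrable_snd[OF H] unfolding inner lborel_prod .
  have K: "(\<integral>y. g y * K (x - y) \<partial>lborel) = (\<integral>z. 2 * pi * gauss2 z * g (x + (- d) *\<^sub>R z) \<partial>lborel)" for x
  proof -
    have "(\<integral>y. g y * K (x - y) \<partial>lborel) = d\<^sup>2 *\<^sub>R (\<integral>z. g (x + (- d) *\<^sub>R z) * K (x - (x + (- d) *\<^sub>R z)) \<partial>lborel)"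
      using lborel_affine_integral[of "- d" "\<lambda>y. g y * K (x - y)" x] d by (simp add: power2_eq_square)
    also have "\<dots> = (\<integral>z. d\<^sup>2 *\<^sub>R (g (x + (- d) *\<^sub>R z) * K (x - (x + (- d) *\<^sub>R z))) \<partial>lborel)"
      by simp
    also have "\<dots> = (\<integral>z. 2 * pi * gauss2 z * g (x + (- d) *\<^sub>R z) \<partial>lborel)"
      using d by (intro Bochner_Integration.integral_cong) (auto simp: K_def scaleR_conv_of_real)
    finally show ?thesis .
  qed
  define L where "L z x = 2 * pi * gauss2 z * (f x * g (x + (- d) *\<^sub>R z))" for z x
  define C where "C = ((\<integral>x. (norm (f x))\<^sup>2 \<partial>lborel) + (\<integral>x. (norm (g x))\<^sup>2 \<partial>lborel)) / 2"
  have L: "integrable (lborel \<Otimes>\<^sub>M lborel) (case_prod L)"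
  proof (rule lborel_pair.Fubini_integrable)
    show "case_prod L \<in> borel_measurable (lborel \<Otimes>\<^sub>M lborel)"
      unfolding L_def by measurable
    show "integrable lborel (\<lambda>z. \<integral>x. norm (case (z, x) of (z, x) \<Rightarrow> L z x) \<partial>lborel)"
    proof (rule Bochner_Integration.integrable_bound)
      show "integrable lborel (\<lambda>z. 2 * pi * C * gauss2 z)"
        using integrable_gauss2 by simp
      show "(\<lambda>z. \<integral>x. norm (case (z, x) of (z, x) \<Rightarrow> L z x) \<partial>lborel) \<in> borel_measurable lborel"
        unfolding L_def by measurable
      show "AE z in lborel. norm (\<integral>x. norm (case (z, x) of (z, x) \<Rightarrow> L z x) \<partial>lborel) \<le> norm (2 * pi * C * gauss2 z)"
      proof (rule AE_I2)
        fix z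
        have "(\<integral>x. norm (L z x) \<partial>lborel) = 2 * pi * gauss2 z * (\<integral>x. norm (f x * g (x + (- d) *\<^sub>R z)) \<partial>lborel)"
          using gauss2_nonneg[of z] by (simp add: L_def norm_mult)
        also have "\<dots> \<le> 2 * pi * gauss2 z * C"
          unfolding C_def using gauss2_nonneg[of z] f2 g2
          by (intro mult_left_mono integrable_translate_mult) auto
        also have "\<dots> \<le> norm (2 * pi * C * gauss2 z)"
          by (simp add: abs_mult) (simp add: mult_ac C_def gauss2_nonneg)
        finally show "norm (\<integral>x. norm (case (z, x) of (z, x) \<Rightarrow> L z x) \<partial>lborel) \<le> norm (2 * pi * C * gauss2 z)"
          by simp
      qed
    qed
    show "AE z in lborel. integrable lborel (\<lambda>x. case (z, x) of (z, x) \<Rightarrow> L z x)"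
      unfolding L_def split
      by (intro AE_I2 integrable_mult_right integrable_translate_mult f2 g2) auto
  qed
  have "(\<integral>w. fourier f w * fourier g (- w) * gauss2 (d *\<^sub>R w) \<partial>lborel) = (\<integral>w. \<integral>p. H w p \<partial>lborel \<partial>lborel)"
    unfolding prod ..
  also have "\<dots> = (\<integral>p. \<integral>w. H w p \<partial>lborel \<partial>lborel)"
    using lborel_pair.Fubini_integral[OF H] by simp
  also have "\<dots> = (\<integral>p. f (fst p) * (g (snd p) * K (fst p - snd p)) \<partial>lborel)"
    unfolding inner ..
  also have "\<dots> = (\<integral>x. \<integral>y. f x * (g y * K (x - y)) \<partial>lborel \<partial>lborel)"
    using lborel_pair.integral_fst'[OF I] by (simp add: lborel_prod)
  also have "\<dots> = (\<integral>x. f x * (\<integral>y. g y * K (x - y) \<partial>lborel) \<partial>lborel)"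
    by simp
  also have "\<dots> = (\<integral>x. f x * (\<integral>z. 2 * pi * gauss2 z * g (x + (- d) *\<^sub>R z) \<partial>lborel) \<partial>lborel)"
    unfolding K ..
  also have "\<dots> = (\<integral>x. \<integral>z. L z x \<partial>lborel \<partial>lborel)"
    unfolding L_def integral_mult_right_zero[symmetric] by (simp only: mult_ac)
  also have "\<dots> = (\<integral>z. \<integral>x. L z x \<partial>lborel \<partial>lborel)"
    by (rule lborel_pair.Fubini_integral[OF L])
  also have "\<dots> = (\<integral>z. 2 * pi * (gauss2 z * (\<integral>x. f x * g (x + (- d) *\<^sub>R z) \<partial>lborel)) \<partial>lborel)"
    unfolding L_def by (simp add: mult.assoc)
  also have "\<dots> = 2 * pi * (\<integral>z. gauss2 z * (\<integral>x. f x * g (x + (- d) *\<^sub>R z) \<partial>lborel) \<partial>lborel)"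
    by simp
  finally show ?thesis .
qed

lemma integrable_gauss2_scaled:
  assumes "d > 0"
  shows "integrable lborel (\<lambda>w. gauss2 (d *\<^sub>R w))"
  using lborel_affine_integrable_iff[of d gauss2 0] integrable_gauss2 assms by simp

lemma tendsto_gauss2_scaled:
  assumes "d \<longlonglongrightarrow> 0"
  shows "(\<lambda>n. gauss2 (d n *\<^sub>R w)) \<longlonglongrightarrow> 1 / (2 * pi)"
proof -
  have "(\<lambda>n. d n *\<^sub>R w) \<longlonglongrightarrow> 0 *\<^sub>R w"
    by (intro tendsto_intros assms)
  from isCont_tendsto_compose[OF isCont_gauss2 this] show ?thesis
    by (simp add: gauss2_0)
qed

lemma fourier_square_gauss2_le:
  fixes f :: "real \<times> real \<Rightarrow> complex"
  assumes f1: "integrable lborel f" and f2: "integrable lborel (\<lambda>x. (norm (f x))\<^sup>2)"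
    and d: "d > 0"
  shows "integrable lborel (\<lambda>w. (norm (fourier f w))\<^sup>2 * gauss2 (d *\<^sub>R w))"
    and "(\<integral>w. (norm (fourier f w))\<^sup>2 * gauss2 (d *\<^sub>R w) \<partial>lborel) \<le> 2 * pi * (\<integral>x. (norm (f x))\<^sup>2 \<partial>lborel)"
proof -
  have cf: "integrable lborel (\<lambda>x. cnj (f x))" using f1 by simp
  have [measurable]: "f \<in> borel_measurable borel" "(\<lambda>x. cnj (f x)) \<in> borel_measurable borel"
    using borel_measurable_integrable[OF f1] borel_measurable_integrable[OF cf] by simp_all
  define S where "S = (\<integral>x. (norm (f x))\<^sup>2 \<partial>lborel)"
  let ?A = "\<integral>x. norm (f x) \<partial>lborel"
  show I: "integrable lborel (\<lambda>w. (norm (fourier f w))\<^sup>2 * gauss2 (d *\<^sub>R w))"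
  proof (rule Bochner_Integration.integrable_bound)
    show "integrable lborel (\<lambda>w. ?A\<^sup>2 * gauss2 (d *\<^sub>R w))"
      using integrable_gauss2_scaled[OF d] by simp
    show "AE w in lborel. norm ((norm (fourier f w))\<^sup>2 * gauss2 (d *\<^sub>R w)) \<le> norm (?A\<^sup>2 * gauss2 (d *\<^sub>R w))"
      using norm_fourier_le[of f]
      by (auto simp: abs_mult gauss2_nonneg intro!: AE_I2 mult_right_mono power_mono)
  qed measurable
  define k where "k z = (\<integral>x. f x * cnj (f (x + (- d) *\<^sub>R z)) \<partial>lborel)" for z
  have k: "norm (k z) \<le> S" for z
  proof -
    have "norm (k z) \<le> (\<integral>x. norm (f x * cnj (f (x + (- d) *\<^sub>R z))) \<partial>lborel)"
      unfolding k_def by (rule integral_norm_bound)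
    also have "\<dots> \<le> S"
      using integrable_translate_mult(2)[of f "\<lambda>x. cnj (f x)" "(- d) *\<^sub>R z"] f2 by (simp add: S_def)
    finally show ?thesis .
  qed
  have km: "k \<in> borel_measurable borel"
    unfolding k_def by measurable
  have "complex_of_real ((norm (fourier f w))\<^sup>2 * gauss2 (d *\<^sub>R w)) =
      fourier f w * fourier (\<lambda>x. cnj (f x)) (- w) * gauss2 (d *\<^sub>R w)" for w
    by (simp only: fourier_cnj complex_norm_square of_real_mult)
  then have "complex_of_real (\<integral>w. (norm (fourier f w))\<^sup>2 * gauss2 (d *\<^sub>R w) \<partial>lborel) =
      (\<integral>w. fourier f w * fourier (\<lambda>x. cnj (f x)) (- w) * gauss2 (d *\<^sub>R w) \<partial>lborel)"
    by (simp only: Bochner_Integration.integral_complex_of_real[symmetric])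
  also have "\<dots> = 2 * pi * (\<integral>z. gauss2 z * k z \<partial>lborel)"
    unfolding k_def by (rule fourier_mult_gauss2) (use f1 f2 d cf in auto)
  finally have "norm (complex_of_real (\<integral>w. (norm (fourier f w))\<^sup>2 * gauss2 (d *\<^sub>R w) \<partial>lborel)) =
      norm (2 * pi * (\<integral>z. gauss2 z * k z \<partial>lborel))"
    by (rule arg_cong)
  then have "\<bar>\<integral>w. (norm (fourier f w))\<^sup>2 * gauss2 (d *\<^sub>R w) \<partial>lborel\<bar> = 2 * pi * norm (\<integral>z. gauss2 z * k z \<partial>lborel)"
    by (simp only: norm_of_real norm_mult) simp
  moreover have "norm (\<integral>z. gauss2 z * k z \<partial>lborel) \<le> (\<integral>z. gauss2 z * S \<partial>lborel)"
  proof (rule Bochner_Integration.integral_norm_bound_integral)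
    show "integrable lborel (\<lambda>z. gauss2 z * S)" using integrable_gauss2 by simp
    then show "integrable lborel (\<lambda>z. gauss2 z * k z)"
      by (rule Bochner_Integration.integrable_bound)
        (use km k in \<open>auto simp: norm_mult abs_mult gauss2_nonneg intro!: AE_I2 mult_left_mono order_trans[OF k]\<close>)
  qed (auto simp: norm_mult gauss2_nonneg intro!: mult_left_mono k)
  ultimately have "\<bar>\<integral>w. (norm (fourier f w))\<^sup>2 * gauss2 (d *\<^sub>R w) \<partial>lborel\<bar> \<le> 2 * pi * S"
    using integral_gauss2 by simp
  then show "(\<integral>w. (norm (fourier f w))\<^sup>2 * gauss2 (d *\<^sub>R w) \<partial>lborel) \<le> 2 * pi * S"
    by linarith
qed

lemma fourier_square_integrable:
  fixes f :: "real \<times> real \<Rightarrow> complex"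
  assumes f1: "integrable lborel f" and f2: "integrable lborel (\<lambda>x. (norm (f x))\<^sup>2)"
  shows "integrable lborel (\<lambda>w. (norm (fourier f w))\<^sup>2)"
proof -
  have [measurable]: "f \<in> borel_measurable borel" using f1 by auto
  define d where "d n = inverse (real (Suc n))" for n
  have d: "d n > 0" "d \<longlonglongrightarrow> 0" for n
    unfolding d_def by (simp_all only: LIMSEQ_inverse_real_of_nat) simp
  let ?F = "\<lambda>n w. (norm (fourier f w))\<^sup>2 * gauss2 (d n *\<^sub>R w)"
  let ?C = "2 * pi * (\<integral>x. (norm (f x))\<^sup>2 \<partial>lborel)"
  have "(\<integral>\<^sup>+w. ennreal ((norm (fourier f w))\<^sup>2 * (1 / (2 * pi))) \<partial>lborel) =
      (\<integral>\<^sup>+w. liminf (\<lambda>n. ennreal (?F n w)) \<partial>lborel)"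
  proof (intro nn_integral_cong)
    fix w
    have "(\<lambda>n. ennreal (?F n w)) \<longlonglongrightarrow> ennreal ((norm (fourier f w))\<^sup>2 * (1 / (2 * pi)))"
      by (intro tendsto_ennrealI tendsto_intros tendsto_gauss2_scaled d)
    then show "ennreal ((norm (fourier f w))\<^sup>2 * (1 / (2 * pi))) = liminf (\<lambda>n. ennreal (?F n w))"
      by (simp add: lim_imp_Liminf)
  qed
  also have "\<dots> \<le> liminf (\<lambda>n. \<integral>\<^sup>+w. ennreal (?F n w) \<partial>lborel)"
    by (rule nn_integral_liminf) measurable
  also have "\<dots> \<le> liminf (\<lambda>n. ennreal ?C)"
  proof (intro Liminf_mono always_eventually allI)
    fix n
    have "(\<integral>\<^sup>+w. ennreal (?F n w) \<partial>lborel) = ennreal (\<integral>w. ?F n w \<partial>lborel)"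
      using fourier_square_gauss2_le(1)[OF f1 f2 d(1)]
      by (intro nn_integral_eq_integral) (auto simp: gauss2_nonneg)
    also have "\<dots> \<le> ennreal ?C"
      by (intro ennreal_leI fourier_square_gauss2_le f1 f2 d)
    finally show "(\<integral>\<^sup>+w. ennreal (?F n w) \<partial>lborel) \<le> ennreal ?C" .
  qed
  also have "\<dots> < \<infinity>" by (simp add: Liminf_const)
  finally have "integrable lborel (\<lambda>w. (norm (fourier f w))\<^sup>2 * (1 / (2 * pi)))"
    by (intro integrableI_nonneg) auto
  then show ?thesis by (simp only: integrable_mult_right_iff) simp
qed

lemma integrable_fourier_mult:
  fixes f g :: "real \<times> real \<Rightarrow> complex"
  assumes f1: "integrable lborel f" and g1: "integrable lborel g"
    and f2: "integrable lborel (\<lambda>x. (norm (f x))\<^sup>2)" and g2: "integrable lborel (\<lambda>x. (norm (g x))\<^sup>2)"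
  shows "integrable lborel (\<lambda>w. fourier f w * fourier g (- w))"
proof (rule integrable_mult_square_integrable)
  have [measurable]: "f \<in> borel_measurable borel" "g \<in> borel_measurable borel"
    using f1 g1 by auto
  show "fourier f \<in> borel_measurable lborel" "(\<lambda>w. fourier g (- w)) \<in> borel_measurable lborel"
    by simp_all
  show "integrable lborel (\<lambda>w. (norm (fourier f w))\<^sup>2)"
    by (rule fourier_square_integrable[OF f1 f2])
  show "integrable lborel (\<lambda>w. (norm (fourier g (- w)))\<^sup>2)"
    using lborel_affine_integrable_iff[of "-1" "\<lambda>w. (norm (fourier g w))\<^sup>2" 0]
      fourier_square_integrable[OF g1 g2] by simp
qed

lemma fourier_parseval:
  fixes f g :: "real \<times> real \<Rightarrow> complex"
  assumes f1: "integrable lborel f" and g1: "integrable lborel g"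
    and f2: "integrable lborel (\<lambda>x. (norm (f x))\<^sup>2)" and g2: "integrable lborel (\<lambda>x. (norm (g x))\<^sup>2)"
  shows "(\<integral>w. fourier f w * fourier g (- w) \<partial>lborel) = (2 * pi)\<^sup>2 * (\<integral>x. f x * g x \<partial>lborel)"
proof -
  have [measurable]: "f \<in> borel_measurable borel" "g \<in> borel_measurable borel"
    using f1 g1 by auto
  define d where "d n = inverse (real (Suc n))" for n
  have d: "d n > 0" "d \<longlonglongrightarrow> 0" for n
    unfolding d_def by (simp_all only: LIMSEQ_inverse_real_of_nat) simp
  define k where "k n z = (\<integral>x. f x * g (x + (- d n) *\<^sub>R z) \<partial>lborel)" for n z
  define S where "S = ((\<integral>x. (norm (f x))\<^sup>2 \<partial>lborel) + (\<integral>x. (norm (g x))\<^sup>2 \<partial>lborel)) / 2"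
  have FG: "integrable lborel (\<lambda>w. fourier f w * fourier g (- w))"
    by (rule integrable_fourier_mult[OF assms])
  have lim1: "(\<lambda>n. \<integral>w. fourier f w * fourier g (- w) * gauss2 (d n *\<^sub>R w) \<partial>lborel) \<longlonglongrightarrow>
      (\<integral>w. fourier f w * fourier g (- w) * of_real (1 / (2 * pi)) \<partial>lborel)"
  proof (rule integral_dominated_convergence)
    show "integrable lborel (\<lambda>w. norm (fourier f w * fourier g (- w)) * (1 / (2 * pi)))"
      using FG by (intro integrable_mult_left integrable_norm) auto
    show "AE w in lborel. (\<lambda>n. fourier f w * fourier g (- w) * of_real (gauss2 (d n *\<^sub>R w))) \<longlonglongrightarrow>
        fourier f w * fourier g (- w) * of_real (1 / (2 * pi))"
      by (intro AE_I2 tendsto_intros tendsto_gauss2_scaled d)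
    show "AE w in lborel. norm (fourier f w * fourier g (- w) * of_real (gauss2 (d n *\<^sub>R w))) \<le>
        norm (fourier f w * fourier g (- w)) * (1 / (2 * pi))" for n
      unfolding norm_mult norm_of_real abs_of_nonneg[OF gauss2_nonneg]
      by (intro AE_I2 mult_left_mono gauss2_le) auto
  qed measurable
  have eq: "(\<integral>w. fourier f w * fourier g (- w) * gauss2 (d n *\<^sub>R w) \<partial>lborel) =
      2 * pi * (\<integral>z. gauss2 z * k n z \<partial>lborel)" for n
    unfolding k_def by (rule fourier_mult_gauss2[OF assms d(1)])
  have lim2: "(\<lambda>n. 2 * pi * (\<integral>z. gauss2 z * k n z \<partial>lborel)) \<longlonglongrightarrow>
      2 * pi * (\<integral>z. gauss2 z * (\<integral>x. f x * g x \<partial>lborel) \<partial>lborel)"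
  proof (intro tendsto_mult_left integral_dominated_convergence)
    show "integrable lborel (\<lambda>z. gauss2 z * S)"
      using integrable_gauss2 by simp
    show "(\<lambda>z. gauss2 z * k n z) \<in> borel_measurable lborel" for n
      unfolding k_def by measurable
    show "AE z in lborel. (\<lambda>n. gauss2 z * k n z) \<longlonglongrightarrow> gauss2 z * (\<integral>x. f x * g x \<partial>lborel)"
    proof (intro AE_I2 tendsto_mult_left)
      fix z :: "real \<times> real"
      have "(\<lambda>n. (- d n) *\<^sub>R z) \<longlonglongrightarrow> (- 0) *\<^sub>R z"
        by (intro tendsto_intros d)
      then show "(\<lambda>n. k n z) \<longlonglongrightarrow> (\<integral>x. f x * g x \<partial>lborel)"
        unfolding k_def by (intro tendsto_integral_translate_mult g1 f2 g2) auto
    qed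
    show "AE z in lborel. norm (gauss2 z * k n z) \<le> gauss2 z * S" for n
    proof (rule AE_I2)
      fix z
      have "norm (k n z) \<le> (\<integral>x. norm (f x * g (x + (- d n) *\<^sub>R z)) \<partial>lborel)"
        unfolding k_def by (rule integral_norm_bound)
      also have "\<dots> \<le> S"
        unfolding S_def by (rule integrable_translate_mult[OF _ _ f2 g2]) auto
      finally show "norm (gauss2 z * k n z) \<le> gauss2 z * S"
        by (simp add: norm_mult gauss2_nonneg mult_left_mono)
    qed
  qed simp
  have "(\<integral>w. fourier f w * fourier g (- w) * of_real (1 / (2 * pi)) \<partial>lborel) =
      2 * pi * (\<integral>z. gauss2 z * (\<integral>x. f x * g x \<partial>lborel) \<partial>lborel)"
    by (rule LIMSEQ_unique[OF lim1[unfolded eq] lim2])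
  also have "(\<integral>w. fourier f w * fourier g (- w) * of_real (1 / (2 * pi)) \<partial>lborel) =
      (\<integral>w. fourier f w * fourier g (- w) \<partial>lborel) * of_real (1 / (2 * pi))"
    by (rule integral_mult_left_zero)
  also have "(\<integral>z. gauss2 z * (\<integral>x. f x * g x \<partial>lborel) \<partial>lborel) = (\<integral>x. f x * g x \<partial>lborel)"
    using integral_gauss2 by simp
  finally show ?thesis
    by (simp add: field_simps power2_eq_square)
qed

lemma fourier_convolution:
  fixes f g :: "real \<times> real \<Rightarrow> complex"
  assumes f1: "integrable lborel f" and g1: "integrable lborel g"
    and f2: "integrable lborel (\<lambda>x. (norm (f x))\<^sup>2)" and g2: "integrable lborel (\<lambda>x. (norm (g x))\<^sup>2)"
  shows "(\<integral>w. fourier f w * fourier g (s - w) \<partial>lborel) = (2 * pi)\<^sup>2 * fourier (\<lambda>x. f x * g x) s"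
proof -
  have "(\<integral>w. fourier f w * fourier (\<lambda>x. cis (- (x \<bullet> s)) * g x) (- w) \<partial>lborel) =
      (2 * pi)\<^sup>2 * (\<integral>x. f x * (cis (- (x \<bullet> s)) * g x) \<partial>lborel)"
    by (rule fourier_parseval) (use assms in \<open>auto intro!: integrable_cis_mult simp: norm_mult\<close>)
  then show ?thesis
    unfolding fourier_modulate by (simp add: fourier_def[of "\<lambda>x. f x * g x"] mult_ac)
qed

section \<open>The complex linear canonical transform\<close>

lemma lborel_integral_scale_pair:
  fixes f :: "real \<times> real \<Rightarrow> 'b::{banach, second_countable_topology}"
  assumes [measurable]: "f \<in> borel_measurable borel" and b: "b1 \<noteq> 0" "b2 \<noteq> 0"
  shows "(\<integral>z. f (fst z / b1, snd z / b2) \<partial>lborel) = \<bar>b1 * b2\<bar> *\<^sub>R (\<integral>z. f z \<partial>lborel)"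
proof -
  define c :: "real \<times> real \<Rightarrow> real" where "c j = (if j = (1, 0) then b1 else b2)" for j
  define T where "T x = 0 + (\<Sum>j\<in>Basis. (c j * (x \<bullet> j)) *\<^sub>R j)" for x
  have basis: "(Basis :: (real \<times> real) set) = {(1, 0), (0, 1)}"
    by (auto simp: Basis_prod_def)
  have T: "T = (\<lambda>x. (b1 * fst x, b2 * snd x))"
    by (auto simp: T_def basis c_def inner_prod_def)
  have [measurable]: "T \<in> borel \<rightarrow>\<^sub>M borel"
    unfolding T by (intro borel_measurable_continuous_onI continuous_intros)
  have "lborel = density (distr lborel borel T) (\<lambda>_. \<Prod>j\<in>Basis. \<bar>c j\<bar>)"
    unfolding T_def by (rule lborel_affine_euclidean) (use b in \<open>simp add: c_def\<close>)
  also have "(\<Prod>j\<in>Basis. \<bar>c j\<bar>) = \<bar>b1 * b2\<bar>"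
    by (simp add: basis c_def abs_mult)
  finally have L: "lborel = density (distr lborel borel T) (\<lambda>_. ennreal \<bar>b1 * b2\<bar>)" .
  have "(\<lambda>z::real \<times> real. (fst z / b1, snd z / b2)) \<in> borel \<rightarrow>\<^sub>M borel"
    using b by (intro borel_measurable_continuous_onI continuous_intros) auto
  from measurable_compose[OF this assms(1)]
  have [measurable]: "(\<lambda>z. f (fst z / b1, snd z / b2)) \<in> borel_measurable borel" .
  have "(\<integral>z. f (fst z / b1, snd z / b2) \<partial>lborel) =
      (\<integral>z. f (fst z / b1, snd z / b2) \<partial>density (distr lborel borel T) (\<lambda>_. ennreal \<bar>b1 * b2\<bar>))"
    using L by simp
  also have "\<dots> = (\<integral>z. \<bar>b1 * b2\<bar> *\<^sub>R f (fst z / b1, snd z / b2) \<partial>distr lborel borel T)"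
    by (subst integral_density) auto
  also have "\<dots> = (\<integral>z. \<bar>b1 * b2\<bar> *\<^sub>R f (fst (T z) / b1, snd (T z) / b2) \<partial>lborel)"
    by (subst integral_distr) auto
  finally show ?thesis
    using b by (simp add: T)
qed

definition complex_lct_kernel :: "real \<Rightarrow> real \<Rightarrow> real \<Rightarrow> real \<Rightarrow> real \<Rightarrow> complex" where
  "complex_lct_kernel a b d x u =
     1 / csqrt (of_real (2 * pi * b) * \<i>) * cis (a / (2 * b) * x\<^sup>2 - 1 / b * x * u + d / (2 * b) * u\<^sup>2)"

definition complex_conv_weight :: "real \<Rightarrow> real \<Rightarrow> real \<Rightarrow> real \<Rightarrow> complex" where
  "complex_conv_weight a b t \<tau> =
     1 / csqrt (of_real (2 * pi * b) * \<i>) * cis (\<tau> * (\<tau> - t) * (a / b))"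

definition complex_lct ::
  "real \<Rightarrow> real \<Rightarrow> real \<Rightarrow> real \<Rightarrow> real \<Rightarrow> real \<Rightarrow> (real \<times> real \<Rightarrow> complex) \<Rightarrow> real \<times> real \<Rightarrow> complex" where
  "complex_lct a1 b1 d1 a2 b2 d2 f w =
     (\<integral>z. complex_lct_kernel a1 b1 d1 (fst z) (fst w) * f z * complex_lct_kernel a2 b2 d2 (snd z) (snd w) \<partial>lborel)"

lemma csqrt_mult_csqrt_minus:
  assumes "b \<noteq> 0"
  shows "csqrt (of_real (2 * pi * b) * \<i>) * csqrt (of_real (2 * pi * (- b)) * \<i>) = of_real (2 * pi * \<bar>b\<bar>)"
proof -
  have "csqrt (cnj (of_real (2 * pi * b) * \<i>)) = cnj (csqrt (of_real (2 * pi * b) * \<i>))"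
    using assms by (intro cnj_csqrt[symmetric]) (auto simp: complex_nonpos_Reals_iff)
  moreover have "of_real (2 * pi * (- b)) * \<i> = cnj (of_real (2 * pi * b) * \<i>)"
    by simp
  ultimately have "csqrt (of_real (2 * pi * b) * \<i>) * csqrt (of_real (2 * pi * (- b)) * \<i>) =
      of_real ((norm (csqrt (of_real (2 * pi * b) * \<i>)))\<^sup>2)"
    by (simp only: complex_norm_square)
  also have "(norm (csqrt (of_real (2 * pi * b) * \<i>)))\<^sup>2 = 2 * pi * \<bar>b\<bar>"
    by (simp only: norm_power[symmetric] power2_csqrt) (simp add: norm_mult abs_mult)
  finally show ?thesis .
qed

lemma complex_lct_eq_fourier:
  "complex_lct a1 b1 d1 a2 b2 d2 f (s, t) =
    1 / csqrt (of_real (2 * pi * b1) * \<i>) * (1 / csqrt (of_real (2 * pi * b2) * \<i>)) *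
    cis (d1 / (2 * b1) * s\<^sup>2 + d2 / (2 * b2) * t\<^sup>2) *
    fourier (\<lambda>z. cis (a1 / (2 * b1) * (fst z)\<^sup>2 + a2 / (2 * b2) * (snd z)\<^sup>2) * f z) (s / b1, t / b2)"
proof -
  let ?c1 = "1 / csqrt (of_real (2 * pi * b1) * \<i>)" and ?c2 = "1 / csqrt (of_real (2 * pi * b2) * \<i>)"
  have "complex_lct_kernel a1 b1 d1 (fst z) s * f z * complex_lct_kernel a2 b2 d2 (snd z) t =
      (?c1 * ?c2 * cis (d1 / (2 * b1) * s\<^sup>2 + d2 / (2 * b2) * t\<^sup>2)) *
      (cis (- (z \<bullet> (s / b1, t / b2))) * (cis (a1 / (2 * b1) * (fst z)\<^sup>2 + a2 / (2 * b2) * (snd z)\<^sup>2) * f z))" for z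
  proof -
    let ?X = "cis (a1 / (2 * b1) * (fst z)\<^sup>2 - 1 / b1 * fst z * s + d1 / (2 * b1) * s\<^sup>2)"
    let ?Y = "cis (a2 / (2 * b2) * (snd z)\<^sup>2 - 1 / b2 * snd z * t + d2 / (2 * b2) * t\<^sup>2)"
    have XY: "?X * ?Y =
        cis (d1 / (2 * b1) * s\<^sup>2 + d2 / (2 * b2) * t\<^sup>2) * cis (- (z \<bullet> (s / b1, t / b2))) *
        cis (a1 / (2 * b1) * (fst z)\<^sup>2 + a2 / (2 * b2) * (snd z)\<^sup>2)"
      unfolding cis_mult by (rule arg_cong[of _ _ cis]) (simp add: inner_prod_def algebra_simps)
    have "?c1 * ?X * f z * (?c2 * ?Y) = ?c1 * ?c2 * (?X * ?Y) * f z"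
      by (simp only: mult_ac)
    then show ?thesis
      unfolding complex_lct_kernel_def XY by (simp only: mult_ac)
  qed
  then show ?thesis
    unfolding complex_lct_def fourier_def fst_conv snd_conv by (simp only: integral_mult_right_zero)
qed

lemma complex_lct_convolution:
  fixes f g :: "real \<times> real \<Rightarrow> complex"
  assumes b: "b1 \<noteq> 0" "b2 \<noteq> 0"
    and f1: "integrable lborel f" and g1: "integrable lborel g"
    and f2: "integrable lborel (\<lambda>x. (norm (f x))\<^sup>2)" and g2: "integrable lborel (\<lambda>x. (norm (g x))\<^sup>2)"
  shows "(\<integral>w. complex_conv_weight d1 (- b1) u (fst w) * complex_lct a1 b1 d1 a2 b2 d2 f w *
            complex_lct a1 b1 d1 a2 b2 d2 g (u - fst w, v - snd w) * complex_conv_weight d2 (- b2) v (snd w) \<partial>lborel) =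
    complex_lct a1 b1 d1 a2 b2 d2
      (\<lambda>z. cis (a1 / (2 * b1) * (fst z)\<^sup>2) * (f z * g z) * cis (a2 / (2 * b2) * (snd z)\<^sup>2)) (u, v)"
proof -
  have [measurable]: "f \<in> borel_measurable borel" "g \<in> borel_measurable borel"
    using f1 g1 by auto
  let ?c1 = "1 / csqrt (of_real (2 * pi * b1) * \<i>)" and ?c2 = "1 / csqrt (of_real (2 * pi * b2) * \<i>)"
  let ?e1 = "1 / csqrt (of_real (2 * pi * (- b1)) * \<i>)" and ?e2 = "1 / csqrt (of_real (2 * pi * (- b2)) * \<i>)"
  define q where "q z = a1 / (2 * b1) * (fst z)\<^sup>2 + a2 / (2 * b2) * (snd z)\<^sup>2" for z :: "real \<times> real"
  define p where "p s t = cis (d1 / (2 * b1) * s\<^sup>2 + d2 / (2 * b2) * t\<^sup>2)" for s t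
  have [measurable]: "q \<in> borel_measurable borel"
    unfolding q_def by (intro borel_measurable_continuous_onI continuous_intros)
  define F G where "F = fourier (\<lambda>z. cis (q z) * f z)" and "G = fourier (\<lambda>z. cis (q z) * g z)"
  have [measurable]: "F \<in> borel_measurable borel" "G \<in> borel_measurable borel"
    unfolding F_def G_def by measurable
  have ce: "?c1 * ?e1 = 1 / (2 * pi * \<bar>b1\<bar>)" "?c2 * ?e2 = 1 / (2 * pi * \<bar>b2\<bar>)"
    using csqrt_mult_csqrt_minus[OF b(1)] csqrt_mult_csqrt_minus[OF b(2)]
    by (simp_all only: times_divide_times_eq mult_1 of_real_divide of_real_1)
  have "complex_conv_weight d1 (- b1) u s * complex_lct a1 b1 d1 a2 b2 d2 f (s, t) *
      complex_lct a1 b1 d1 a2 b2 d2 g (u - s, v - t) * complex_conv_weight d2 (- b2) v t =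
      (?c1 * ?c2 * p u v * ((?c1 * ?e1) * (?c2 * ?e2))) * (F (s / b1, t / b2) * G ((u / b1, v / b2) - (s / b1, t / b2)))" for s t
  proof -
    let ?X = "cis (s * (s - u) * (d1 / - b1))" and ?Y = "cis (t * (t - v) * (d2 / - b2))"
    have XY: "?X * p s t * p (u - s) (v - t) * ?Y = p u v"
      unfolding p_def cis_mult using b
      by (intro arg_cong[of _ _ cis]) (simp add: field_simps power2_eq_square)
    have st: "((u - s) / b1, (v - t) / b2) = (u / b1, v / b2) - (s / b1, t / b2)"
      by (simp add: diff_divide_distrib)
    have "?e1 * ?X * (?c1 * ?c2 * p s t * A) * (?c1 * ?c2 * p (u - s) (v - t) * B) * (?e2 * ?Y) =
        ?c1 * ?c2 * (?X * p s t * p (u - s) (v - t) * ?Y) * ((?c1 * ?e1) * (?c2 * ?e2)) * (A * B)" for A B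
      by (simp only: mult_ac)
    then show ?thesis
      unfolding complex_lct_eq_fourier complex_conv_weight_def p_def[symmetric] q_def[symmetric]
        F_def[symmetric] G_def[symmetric] XY st .
  qed
  then have "(\<integral>w. complex_conv_weight d1 (- b1) u (fst w) * complex_lct a1 b1 d1 a2 b2 d2 f w *
      complex_lct a1 b1 d1 a2 b2 d2 g (u - fst w, v - snd w) * complex_conv_weight d2 (- b2) v (snd w) \<partial>lborel) =
      (?c1 * ?c2 * p u v * ((?c1 * ?e1) * (?c2 * ?e2))) *
      (\<integral>w. F (fst w / b1, snd w / b2) * G ((u / b1, v / b2) - (fst w / b1, snd w / b2)) \<partial>lborel)"
    by (subst integral_mult_right_zero[symmetric], intro Bochner_Integration.integral_cong refl)
      (simp only: split_paired_all fst_conv snd_conv)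
  also have "(\<integral>w. F (fst w / b1, snd w / b2) * G ((u / b1, v / b2) - (fst w / b1, snd w / b2)) \<partial>lborel) =
      \<bar>b1 * b2\<bar> *\<^sub>R (\<integral>w. F w * G ((u / b1, v / b2) - w) \<partial>lborel)"
    by (rule lborel_integral_scale_pair[OF _ b]) measurable
  also have "(\<integral>w. F w * G ((u / b1, v / b2) - w) \<partial>lborel) =
      (2 * pi)\<^sup>2 * fourier (\<lambda>z. (cis (q z) * f z) * (cis (q z) * g z)) (u / b1, v / b2)"
    unfolding F_def G_def
    by (rule fourier_convolution) (use assms in \<open>auto intro!: integrable_cis_mult simp: norm_mult\<close>)
  also have "?c1 * ?c2 * p u v * ((?c1 * ?e1) * (?c2 * ?e2)) * (\<bar>b1 * b2\<bar> *\<^sub>R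
      ((2 * pi)\<^sup>2 * fourier (\<lambda>z. (cis (q z) * f z) * (cis (q z) * g z)) (u / b1, v / b2))) =
      ?c1 * ?c2 * p u v * fourier (\<lambda>z. (cis (q z) * f z) * (cis (q z) * g z)) (u / b1, v / b2)"
  proof -
    have one: "complex_of_real (1 / (2 * pi * \<bar>b1\<bar>)) * of_real (1 / (2 * pi * \<bar>b2\<bar>)) *
        (of_real \<bar>b1 * b2\<bar> * of_real ((2 * pi)\<^sup>2)) = 1"
      using b unfolding of_real_mult[symmetric] of_real_eq_1_iff
      by (simp add: abs_mult field_simps power2_eq_square)
    have assoc: "X * (P * Q) * (r * (w * Y)) = X * (P * Q * (r * w)) * Y" for X P Q r w Y :: complex
      by (simp only: mult_ac)
    have pi: "(2 * complex_of_real pi)\<^sup>2 = of_real ((2 * pi)\<^sup>2)"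
      by simp
    show ?thesis
      unfolding ce scaleR_conv_of_real pi assoc one by (simp only: mult_1_right)
  qed
  also have "(\<lambda>z. (cis (q z) * f z) * (cis (q z) * g z)) =
      (\<lambda>z. cis (q z) * (cis (a1 / (2 * b1) * (fst z)\<^sup>2) * (f z * g z) * cis (a2 / (2 * b2) * (snd z)\<^sup>2)))"
  proof
    fix z
    have "cis (q z) = cis (a1 / (2 * b1) * (fst z)\<^sup>2) * cis (a2 / (2 * b2) * (snd z)\<^sup>2)"
      by (simp add: q_def cis_mult)
    then show "(cis (q z) * f z) * (cis (q z) * g z) =
        cis (q z) * (cis (a1 / (2 * b1) * (fst z)\<^sup>2) * (f z * g z) * cis (a2 / (2 * b2) * (snd z)\<^sup>2))"
      by (simp only: mult_ac)
  qed
  finally show ?thesis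
    unfolding complex_lct_eq_fourier p_def q_def .
qed

section \<open>Transfer to quaternions\<close>

lemma quat_of_complex_simps [simp]:
  "qre (quat_of_complex z) = Re z" "qmu (quat_of_complex z) = Im z"
  "qnu (quat_of_complex z) = 0" "qeta (quat_of_complex z) = 0"
  by (simp_all add: quat_of_complex_def)

lemma quat_of_complex_add: "quat_of_complex (y + z) = quat_of_complex y + quat_of_complex z"
  by (simp add: quat_eq_iff)

lemma quat_of_complex_diff: "quat_of_complex (y - z) = quat_of_complex y - quat_of_complex z"
  by (simp add: quat_eq_iff)

lemma quat_of_complex_mult: "quat_of_complex (y * z) = quat_of_complex y * quat_of_complex z"
  by (simp add: quat_eq_iff)

lemma quat_of_complex_1 [simp]: "quat_of_complex 1 = 1"
  by (simp add: quat_eq_iff)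

lemma quat_of_complex_0 [simp]: "quat_of_complex 0 = 0"
  by (simp add: quat_eq_iff)

lemma quat_of_complex_power: "quat_of_complex (z ^ n) = quat_of_complex z ^ n"
  by (induction n) (simp_all add: quat_of_complex_mult)

lemma quat_of_complex_cnj: "quat_of_complex (cnj z) = qcnj (quat_of_complex z)"
  by (simp add: quat_eq_iff)

lemma nu_mult_quat_of_complex: "\<nu> * quat_of_complex z = quat_of_complex (cnj z) * \<nu>"
  by (simp add: quat_eq_iff q_units_def)

lemma norm_quat_of_complex [simp]: "norm (quat_of_complex z) = norm z"
  by (simp add: norm_quat_def cmod_def)

lemma quat_of_complex_inverse: "quat_of_complex (inverse z) = inverse (quat_of_complex z)"
proof (cases "z = 0")
  case False
  then have "quat_of_complex z * quat_of_complex (inverse z) = 1"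
    by (simp flip: quat_of_complex_mult)
  then show ?thesis by (rule inverse_unique[symmetric])
qed simp

lemma bounded_linear_quat_of_complex: "bounded_linear quat_of_complex"
  by (rule bounded_linear_intro[where K = 1]) (simp_all add: quat_eq_iff)

definition complex_of_quat :: "quat \<Rightarrow> complex" where
  "complex_of_quat q = Complex (qre q) (qmu q)"

definition complex_of_quat_nu :: "quat \<Rightarrow> complex" where
  "complex_of_quat_nu q = Complex (qnu q) (qeta q)"

lemma complex_of_quat_of_complex [simp]: "complex_of_quat (quat_of_complex z) = z"
  by (simp add: complex_of_quat_def complex_eq_iff)

lemma norm_complex_of_quat_le:
  "norm (complex_of_quat q) \<le> norm q" "norm (complex_of_quat_nu q) \<le> norm q"
  by (simp_all add: complex_of_quat_def complex_of_quat_nu_def cmod_def norm_quat_def)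

lemma bounded_linear_complex_of_quat: "bounded_linear complex_of_quat"
  by (rule bounded_linear_intro[where K = 1])
     (use norm_complex_of_quat_le in \<open>simp_all add: complex_of_quat_def complex_eq_iff\<close>)

lemma bounded_linear_complex_of_quat_nu: "bounded_linear complex_of_quat_nu"
  by (rule bounded_linear_intro[where K = 1])
     (use norm_complex_of_quat_le in \<open>simp_all add: complex_of_quat_nu_def complex_eq_iff\<close>)

lemma integral_quat_of_complex:
  "(\<integral>x. quat_of_complex (f x) \<partial>M) = quat_of_complex (\<integral>x. f x \<partial>M)"
  by (rule integral_bounded_linear'[OF bounded_linear_quat_of_complex bounded_linear_complex_of_quat]) simp

lemma quat_of_complex_exp: "quat_of_complex (exp z) = exp (quat_of_complex z)"
proof -
  interpret bounded_linear quat_of_complex by (rule bounded_linear_quat_of_complex)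
  have "quat_of_complex (\<Sum>n. z ^ n /\<^sub>R fact n) = (\<Sum>n. quat_of_complex (z ^ n /\<^sub>R fact n))"
    by (rule suminf[OF summable_exp_generic])
  then show ?thesis
    by (simp add: exp_def scaleR quat_of_complex_power)
qed

lemma exp_mu: "exp (\<mu> * of_real t) = quat_of_complex (cis t)"
proof -
  have "\<mu> * of_real t = quat_of_complex (\<i> * of_real t)"
    by (simp add: quat_eq_iff q_units_def of_real_def)
  then show ?thesis
    by (simp add: cis_conv_exp quat_of_complex_exp)
qed

lemma inverse_q_sqrt_mu:
  "1 / q_sqrt (of_real r * \<mu>) = quat_of_complex (1 / csqrt (of_real r * \<i>))"
proof -
  have "Complex (qre (of_real r * \<mu>)) (qmu (of_real r * \<mu>)) = of_real r * \<i>"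
    by (simp add: complex_eq_iff q_units_def of_real_def)
  then show ?thesis
    by (simp add: q_sqrt_def divide_quat_def divide_complex_def quat_of_complex_inverse)
qed

lemma of_real_mult_scaleR_mu: "of_real r * (\<sigma> *\<^sub>R \<mu>) = of_real (r * \<sigma>) * \<mu>"
  by (simp add: quat_eq_iff q_units_def of_real_def)

text \<open>Replacing \<open>\<mu>\<close> by \<open>- \<mu>\<close> in kernel and weight amounts to changing the sign of \<open>b\<close>.\<close>

lemma lct_kernel_complex:
  assumes "\<sigma> = 1 \<or> \<sigma> = -1"
  shows "lct_kernel (\<sigma> *\<^sub>R \<mu>) A x u =
    quat_of_complex (complex_lct_kernel (A$1$1) (\<sigma> * A$1$2) (A$2$2) x u)"
proof -
  have "of_real (2 * pi * A$1$2) * (\<sigma> *\<^sub>R \<mu>) = of_real (2 * pi * (\<sigma> * A$1$2)) * \<mu>"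
    using of_real_mult_scaleR_mu[of "2 * pi * A$1$2" \<sigma>] by (simp only: mult_ac)
  moreover have "\<sigma> *\<^sub>R \<mu> * of_real t = \<mu> * of_real (\<sigma> * t)" for t
    by (simp add: quat_eq_iff q_units_def of_real_def)
  moreover have "\<sigma> * (A$1$1 / (2 * A$1$2) * x\<^sup>2 - 1 / A$1$2 * x * u + A$2$2 / (2 * A$1$2) * u\<^sup>2) =
      A$1$1 / (2 * (\<sigma> * A$1$2)) * x\<^sup>2 - 1 / (\<sigma> * A$1$2) * x * u + A$2$2 / (2 * (\<sigma> * A$1$2)) * u\<^sup>2"
    using assms by auto
  ultimately show ?thesis
    unfolding lct_kernel_def complex_lct_kernel_def
    by (simp only: inverse_q_sqrt_mu exp_mu quat_of_complex_mult)
qed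

lemma conv_weight_complex:
  assumes "\<sigma> = 1 \<or> \<sigma> = -1"
  shows "conv_weight (\<sigma> *\<^sub>R \<mu>) A t s =
    quat_of_complex (complex_conv_weight (A$1$1) (\<sigma> * A$1$2) t s)"
proof -
  have "of_real (2 * pi * A$1$2) * (\<sigma> *\<^sub>R \<mu>) = of_real (2 * pi * (\<sigma> * A$1$2)) * \<mu>"
    using of_real_mult_scaleR_mu[of "2 * pi * A$1$2" \<sigma>] by (simp only: mult_ac)
  moreover have "\<sigma> *\<^sub>R \<mu> * of_real t = \<mu> * of_real (\<sigma> * t)" for t
    by (simp add: quat_eq_iff q_units_def of_real_def)
  moreover have "\<sigma> * (s * (s - t) * (A$1$1 / A$1$2)) = s * (s - t) * (A$1$1 / (\<sigma> * A$1$2))"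
    using assms by auto
  ultimately show ?thesis
    unfolding conv_weight_def complex_conv_weight_def
    by (simp only: inverse_q_sqrt_mu exp_mu quat_of_complex_mult)
qed

lemma cnj_complex_lct_kernel:
  assumes "b \<noteq> 0"
  shows "cnj (complex_lct_kernel a b d x u) = complex_lct_kernel a (- b) d x u"
proof -
  have "cnj (csqrt (of_real (2 * pi * b) * \<i>)) = csqrt (cnj (of_real (2 * pi * b) * \<i>))"
    using assms by (intro cnj_csqrt) (auto simp: complex_nonpos_Reals_iff)
  also have "cnj (of_real (2 * pi * b) * \<i>) = of_real (2 * pi * (- b)) * \<i>"
    by simp
  finally have c: "cnj (csqrt (of_real (2 * pi * b) * \<i>)) = csqrt (of_real (2 * pi * (- b)) * \<i>)" .
  show ?thesis
    unfolding complex_lct_kernel_def complex_cnj_mult complex_cnj_divide c cis_cnj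
    by (simp add: diff_divide_distrib)
qed

lemma complex_lebesgue_measurable_borel_version:
  fixes f :: "'a::euclidean_space \<Rightarrow> complex"
  assumes f: "f \<in> borel_measurable lebesgue"
  obtains g where "g \<in> borel_measurable borel" "AE x in lborel. f x = g x"
proof -
  have "(\<lambda>x. Re (f x)) \<in> borel_measurable lebesgue" "(\<lambda>x. Im (f x)) \<in> borel_measurable lebesgue"
    using f by measurable
  then obtain r i where ri: "r \<in> borel_measurable lborel" "AE x in lborel. Re (f x) = r x"
    "i \<in> borel_measurable lborel" "AE x in lborel. Im (f x) = i x"
    using completion_ex_borel_measurable_real by metis
  show ?thesis
  proof (rule that[of "\<lambda>x. Complex (r x) (i x)"])
    show "(\<lambda>x. Complex (r x) (i x)) \<in> borel_measurable borel"
      using ri by (subst borel_measurable_complex_iff) simp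
    show "AE x in lborel. f x = Complex (r x) (i x)"
      using ri(2,4) by eventually_elim (simp add: complex_eq_iff)
  qed
qed

lemma
  fixes f g :: "'a::euclidean_space \<Rightarrow> 'b::{banach, second_countable_topology}"
  assumes f: "f \<in> borel_measurable lebesgue" and g: "g \<in> borel_measurable borel"
    and eq: "AE x in lborel. f x = g x"
  shows lebesgue_integral_borel_version: "(\<integral>x. f x \<partial>lebesgue) = (\<integral>x. g x \<partial>lborel)"
    and lebesgue_integrable_borel_version: "integrable lebesgue f \<longleftrightarrow> integrable lborel g"
proof -
  have g': "g \<in> borel_measurable lborel" "g \<in> borel_measurable lebesgue"
    using g by (auto intro: measurable_completion)
  have eq': "AE x in lebesgue. f x = g x"
    using eq by (rule AE_completion)
  show "(\<integral>x. f x \<partial>lebesgue) = (\<integral>x. g x \<partial>lborel)"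
    using integral_cong_AE[OF f g'(2) eq'] integral_completion[OF g'(1)] by simp
  show "integrable lebesgue f \<longleftrightarrow> integrable lborel g"
    using integrable_cong_AE[OF f g'(2) eq'] integrable_completion[OF g'(1)] by simp
qed

lemma borel_measurable_complex_lct_kernel [measurable]:
  "(\<lambda>x. complex_lct_kernel a b d x u) \<in> borel_measurable borel"
  unfolding complex_lct_kernel_def by measurable

lemma borel_measurable_compose_fst_snd:
  fixes h :: "real \<Rightarrow> 'b::topological_space"
  assumes [measurable]: "h \<in> borel_measurable borel"
  shows "(\<lambda>z::real \<times> real. h (fst z)) \<in> borel_measurable borel"
    "(\<lambda>z::real \<times> real. h (snd z)) \<in> borel_measurable borel"
  by (rule measurable_compose[OF _ assms], intro borel_measurable_continuous_onI continuous_intros)+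

lemma qlct_complex:
  fixes f :: "real \<times> real \<Rightarrow> complex"
  assumes \<sigma>: "\<sigma> = 1 \<or> \<sigma> = -1"
    and f: "f \<in> borel_measurable lebesgue" and g: "g \<in> borel_measurable borel"
    and eq: "AE x in lborel. f x = g x"
  shows "qlct \<mu> (\<sigma> *\<^sub>R \<mu>) A1 A2 (\<lambda>z. quat_of_complex (f z)) w =
    quat_of_complex (complex_lct (A1$1$1) (A1$1$2) (A1$2$2) (A2$1$1) (\<sigma> * A2$1$2) (A2$2$2) g w)"
proof -
  define k where "k z = complex_lct_kernel (A1$1$1) (A1$1$2) (A1$2$2) (fst z) (fst w) *
    complex_lct_kernel (A2$1$1) (\<sigma> * A2$1$2) (A2$2$2) (snd z) (snd w)" for z
  have k[measurable]: "k \<in> borel_measurable borel"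
    unfolding k_def by (intro borel_measurable_times borel_measurable_compose_fst_snd) auto
  have "qlct \<mu> (\<sigma> *\<^sub>R \<mu>) A1 A2 (\<lambda>z. quat_of_complex (f z)) w = (\<integral>z. quat_of_complex (k z * f z) \<partial>lebesgue)"
    using lct_kernel_complex[of 1] lct_kernel_complex[OF \<sigma>]
    by (simp add: qlct_def case_prod_unfold k_def flip: quat_of_complex_mult) (simp add: mult_ac)
  also have "\<dots> = quat_of_complex (\<integral>z. k z * f z \<partial>lebesgue)"
    by (rule integral_quat_of_complex)
  also have "(\<integral>z. k z * f z \<partial>lebesgue) = (\<integral>z. k z * g z \<partial>lborel)"
  proof (rule lebesgue_integral_borel_version)
    show "(\<lambda>z. k z * f z) \<in> borel_measurable lebesgue"
      using k f by (intro borel_measurable_times) (auto intro: measurable_completion)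
    show "(\<lambda>z. k z * g z) \<in> borel_measurable borel"
      using g by measurable
    show "AE z in lborel. k z * f z = k z * g z"
      using eq by eventually_elim simp
  qed
  also have "\<dots> = complex_lct (A1$1$1) (A1$1$2) (A1$2$2) (A2$1$1) (\<sigma> * A2$1$2) (A2$2$2) g w"
    unfolding complex_lct_def k_def by (simp add: mult_ac)
  finally show ?thesis .
qed

lemma borel_measurable_complex_lct:
  assumes [measurable]: "f \<in> borel_measurable borel"
  shows "complex_lct a1 b1 d1 a2 b2 d2 f \<in> borel_measurable borel"
proof -
  define h where "h z = cis (a1 / (2 * b1) * (fst z)\<^sup>2 + a2 / (2 * b2) * (snd z)\<^sup>2) * f z" for z
  have "h \<in> borel_measurable borel"
    unfolding h_def
    by (intro borel_measurable_times measurable_compose[OF _ borel_measurable_cis] assms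
        borel_measurable_continuous_onI continuous_intros)
  then have F: "fourier h \<in> borel_measurable borel" by measurable
  have "(\<lambda>w::real \<times> real. (fst w * inverse b1, snd w * inverse b2)) \<in> borel \<rightarrow>\<^sub>M borel"
    by (intro borel_measurable_continuous_onI continuous_intros)
  from measurable_compose[OF this F]
  have "(\<lambda>w. fourier h (fst w / b1, snd w / b2)) \<in> borel_measurable borel"
    by (simp add: divide_inverse)
  moreover have "complex_lct a1 b1 d1 a2 b2 d2 f = (\<lambda>w. 1 / csqrt (of_real (2 * pi * b1) * \<i>) *
      (1 / csqrt (of_real (2 * pi * b2) * \<i>)) * cis (d1 / (2 * b1) * (fst w)\<^sup>2 + d2 / (2 * b2) * (snd w)\<^sup>2) *
      fourier h (fst w / b1, snd w / b2))"
    unfolding h_def by (simp add: fun_eq_iff complex_lct_eq_fourier del: times_divide_eq_right)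
  moreover have "(\<lambda>w::real \<times> real. cis (d1 / (2 * b1) * (fst w)\<^sup>2 + d2 / (2 * b2) * (snd w)\<^sup>2)) \<in> borel_measurable borel"
    by (intro measurable_compose[OF _ borel_measurable_cis] borel_measurable_continuous_onI continuous_intros)
  ultimately show ?thesis
    by (simp only:) (intro borel_measurable_times borel_measurable_const)
qed

lemma matrix_inv_entries:
  fixes A :: "real^2^2"
  assumes "det A = 1"
  shows "matrix_inv A $ 1 $ 1 = A $ 2 $ 2" "matrix_inv A $ 1 $ 2 = - A $ 1 $ 2"
  by (simp_all add: matrix_inv_2[OF assms])

lemma spatial_conv_qlct:
  fixes f g :: "real \<times> real \<Rightarrow> complex" and u v :: real
  assumes A: "det A1 = 1" "A1$1$2 \<noteq> 0" "det A2 = 1" "A2$1$2 \<noteq> 0"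
    and \<sigma>: "\<sigma> = 1 \<or> \<sigma> = -1"
    and f: "integrable lebesgue f" "integrable lebesgue (\<lambda>z. (norm (f z))\<^sup>2)"
    and g: "integrable lebesgue g" "integrable lebesgue (\<lambda>z. (norm (g z))\<^sup>2)"
  defines "T \<equiv> \<lambda>z. complex_lct_kernel (A1$1$1) (A1$1$2) (A1$2$2) (fst z) u *
      (cis (A1$1$1 / (2 * A1$1$2) * (fst z)\<^sup>2) * (f z * g z) * cis (A2$1$1 / (2 * (\<sigma> * A2$1$2)) * (snd z)\<^sup>2)) *
      complex_lct_kernel (A2$1$1) (\<sigma> * A2$1$2) (A2$2$2) (snd z) v"
  shows "integrable lebesgue T"
    and "spatial_conv \<mu> (\<sigma> *\<^sub>R \<mu>) (matrix_inv A1) (matrix_inv A2)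
       (qlct \<mu> (\<sigma> *\<^sub>R \<mu>) A1 A2 (\<lambda>z. quat_of_complex (f z)))
       (qlct \<mu> (\<sigma> *\<^sub>R \<mu>) A1 A2 (\<lambda>z. quat_of_complex (g z))) (u, v) = quat_of_complex (\<integral>z. T z \<partial>lebesgue)"
proof -
  have fm: "f \<in> borel_measurable lebesgue" and gm: "g \<in> borel_measurable lebesgue"
    using f(1) g(1) by auto
  obtain f' where f': "f' \<in> borel_measurable borel" "AE z in lborel. f z = f' z"
    using complex_lebesgue_measurable_borel_version[OF fm] .
  obtain g' where g': "g' \<in> borel_measurable borel" "AE z in lborel. g z = g' z"
    using complex_lebesgue_measurable_borel_version[OF gm] .
  note [measurable] = f'(1) g'(1)
  have f'1: "integrable lborel f'"
    using f(1) lebesgue_integrable_borel_version[OF fm f'] by simp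
  have g'1: "integrable lborel g'"
    using g(1) lebesgue_integrable_borel_version[OF gm g'] by simp
  have f'2: "integrable lborel (\<lambda>z. (norm (f' z))\<^sup>2)"
  proof (subst lebesgue_integrable_borel_version[symmetric])
    show "(\<lambda>z. (norm (f z))\<^sup>2) \<in> borel_measurable lebesgue" using fm by measurable
    show "AE z in lborel. (norm (f z))\<^sup>2 = (norm (f' z))\<^sup>2" using f'(2) by eventually_elim simp
  qed (use f(2) in auto)
  have g'2: "integrable lborel (\<lambda>z. (norm (g' z))\<^sup>2)"
  proof (subst lebesgue_integrable_borel_version[symmetric])
    show "(\<lambda>z. (norm (g z))\<^sup>2) \<in> borel_measurable lebesgue" using gm by measurable
    show "AE z in lborel. (norm (g z))\<^sup>2 = (norm (g' z))\<^sup>2" using g'(2) by eventually_elim simp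
  qed (use g(2) in auto)
  define k where "k z = complex_lct_kernel (A1$1$1) (A1$1$2) (A1$2$2) (fst z) u *
      cis (A1$1$1 / (2 * A1$1$2) * (fst z)\<^sup>2) * cis (A2$1$1 / (2 * (\<sigma> * A2$1$2)) * (snd z)\<^sup>2) *
      complex_lct_kernel (A2$1$1) (\<sigma> * A2$1$2) (A2$2$2) (snd z) v" for z
  have k[measurable]: "k \<in> borel_measurable borel"
    unfolding k_def by (intro borel_measurable_times borel_measurable_compose_fst_snd) measurable
  define C where "C = norm (1 / csqrt (of_real (2 * pi * A1$1$2) * \<i>)) *
    norm (1 / csqrt (of_real (2 * pi * (\<sigma> * A2$1$2)) * \<i>))"
  have C: "norm (k z) = C" for z
    by (simp add: k_def C_def complex_lct_kernel_def norm_mult norm_divide)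
  have T: "T = (\<lambda>z. k z * (f z * g z))"
    by (rule ext) (simp only: T_def k_def mult_ac)
  have Tm: "T \<in> borel_measurable lebesgue"
    unfolding T using k fm gm by (intro borel_measurable_times) (auto intro: measurable_completion)
  have Teq: "AE z in lborel. T z = k z * (f' z * g' z)"
    using f'(2) g'(2) unfolding T by eventually_elim simp
  have T'm: "(\<lambda>z. k z * (f' z * g' z)) \<in> borel_measurable borel"
    by measurable
  have fg: "integrable lborel (\<lambda>z. f' z * g' z)"
    by (rule integrable_mult_square_integrable[OF _ _ f'2 g'2]) auto
  have "integrable lborel (\<lambda>z. C * (f' z * g' z))"
    using fg by simp
  then have "integrable lborel (\<lambda>z. k z * (f' z * g' z))"
    by (rule Bochner_Integration.integrable_bound) (auto simp: norm_mult C intro!: mult_right_mono)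
  then show "integrable lebesgue T"
    using lebesgue_integrable_borel_version[OF Tm T'm Teq] by simp
  let ?L = "complex_lct (A1$1$1) (A1$1$2) (A1$2$2) (A2$1$1) (\<sigma> * A2$1$2) (A2$2$2)"
  have b: "A1$1$2 \<noteq> 0" "\<sigma> * A2$1$2 \<noteq> 0"
    using A \<sigma> by auto
  define S where "S w = complex_conv_weight (A1$2$2) (- A1$1$2) u (fst w) * ?L f' w * ?L g' (u - fst w, v - snd w) *
    complex_conv_weight (A2$2$2) (- (\<sigma> * A2$1$2)) v (snd w)" for w
  have "spatial_conv \<mu> (\<sigma> *\<^sub>R \<mu>) (matrix_inv A1) (matrix_inv A2)
       (qlct \<mu> (\<sigma> *\<^sub>R \<mu>) A1 A2 (\<lambda>z. quat_of_complex (f z)))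
       (qlct \<mu> (\<sigma> *\<^sub>R \<mu>) A1 A2 (\<lambda>z. quat_of_complex (g z))) (u, v) = (\<integral>w. quat_of_complex (S w) \<partial>lebesgue)"
    using conv_weight_complex[of 1 "matrix_inv A1"] conv_weight_complex[OF \<sigma>, of "matrix_inv A2"]
    by (simp add: spatial_conv_def case_prod_unfold S_def qlct_complex[OF \<sigma> fm f'] qlct_complex[OF \<sigma> gm g']
        matrix_inv_entries A quat_of_complex_mult)
  also have "\<dots> = quat_of_complex (\<integral>w. S w \<partial>lebesgue)"
    by (rule integral_quat_of_complex)
  also have "(\<integral>w. S w \<partial>lebesgue) = (\<integral>w. S w \<partial>lborel)"
  proof (rule lebesgue_integral_borel_version)
    show S: "S \<in> borel_measurable borel"
      unfolding S_def complex_conv_weight_def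
      by (intro borel_measurable_times measurable_compose[OF _ borel_measurable_cis]
          borel_measurable_complex_lct f'(1) g'(1)
          measurable_compose[OF _ borel_measurable_complex_lct[OF g'(1)]])
        (intro borel_measurable_continuous_onI continuous_intros)+
    show "S \<in> borel_measurable lebesgue"
      using S by (auto intro: measurable_completion)
  qed simp
  also have "\<dots> = ?L (\<lambda>z. cis (A1$1$1 / (2 * A1$1$2) * (fst z)\<^sup>2) * (f' z * g' z) *
      cis (A2$1$1 / (2 * (\<sigma> * A2$1$2)) * (snd z)\<^sup>2)) (u, v)"
    unfolding S_def by (rule complex_lct_convolution[OF b f'1 g'1 f'2 g'2])
  also have "\<dots> = (\<integral>z. k z * (f' z * g' z) \<partial>lborel)"
    unfolding complex_lct_def k_def by (simp add: mult_ac)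
  also have "\<dots> = (\<integral>z. T z \<partial>lebesgue)"
    by (rule lebesgue_integral_borel_version[OF Tm T'm Teq, symmetric])
  finally show "spatial_conv \<mu> (\<sigma> *\<^sub>R \<mu>) (matrix_inv A1) (matrix_inv A2)
       (qlct \<mu> (\<sigma> *\<^sub>R \<mu>) A1 A2 (\<lambda>z. quat_of_complex (f z)))
       (qlct \<mu> (\<sigma> *\<^sub>R \<mu>) A1 A2 (\<lambda>z. quat_of_complex (g z))) (u, v) = quat_of_complex (\<integral>z. T z \<partial>lebesgue)" .
qed

lemma Lp_integrable_compose:
  fixes L :: "quat \<Rightarrow> complex"
  assumes f: "f \<in> Lp 1 \<inter> Lp 2" and L: "bounded_linear L" and le: "\<And>q. norm (L q) \<le> norm q"
  shows "integrable lebesgue (\<lambda>z. L (f z))" "integrable lebesgue (\<lambda>z. (norm (L (f z)))\<^sup>2)"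
proof -
  have fm: "f \<in> borel_measurable lebesgue"
    and f1: "(\<integral>\<^sup>+ z. ennreal (norm (f z)) \<partial>lebesgue) < \<infinity>"
    and f2: "(\<integral>\<^sup>+ z. ennreal ((norm (f z))\<^sup>2) \<partial>lebesgue) < \<infinity>"
    using f by (simp_all add: Lp_def one_enat_def numeral_eq_enat)
  have "L \<in> borel_measurable borel"
    by (intro borel_measurable_continuous_onI linear_continuous_on L)
  from measurable_compose[OF fm this] have Lf[measurable]: "(\<lambda>z. L (f z)) \<in> borel_measurable lebesgue" .
  have "integrable lebesgue f"
    using fm f1 by (rule integrableI_bounded)
  then show "integrable lebesgue (\<lambda>z. L (f z))"
    by (rule Bochner_Integration.integrable_bound) (use le in auto)
  have "integrable lebesgue (\<lambda>z. (norm (f z))\<^sup>2)"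
    using fm f2 by (intro integrableI_bounded) auto
  then show "integrable lebesgue (\<lambda>z. (norm (L (f z)))\<^sup>2)"
    by (rule Bochner_Integration.integrable_bound) (use le in \<open>auto intro!: power_mono\<close>)
qed

lemma H_mu_components:
  assumes "a \<in> H_mu" "b \<in> H_mu" "q = a + b * \<nu>"
  shows "a = quat_of_complex (complex_of_quat q)" "b = quat_of_complex (complex_of_quat_nu q)"
  using assms by (simp_all add: H_mu_iff quat_eq_iff q_units_def complex_of_quat_def complex_of_quat_nu_def)

lemma quat_mult_components:
  "(quat_of_complex a + quat_of_complex b * \<nu>) * (quat_of_complex c + quat_of_complex d * \<nu>) =
    quat_of_complex (a * c - b * cnj d) + quat_of_complex (b * cnj c + a * d) * \<nu>"
  by (simp add: quat_eq_iff q_units_def algebra_simps)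

lemma quat_of_complex_conjugated_mult:
  "quat_of_complex m * (quat_of_complex p + quat_of_complex q * \<nu>) * quat_of_complex n =
    quat_of_complex (m * p * n) + quat_of_complex (m * q * cnj n) * \<nu>"
  by (simp add: quat_of_complex_mult distrib_left distrib_right mult.assoc nu_mult_quat_of_complex)

lemma lct_kernel_mu:
  "lct_kernel \<mu> A x u = quat_of_complex (complex_lct_kernel (A$1$1) (A$1$2) (A$2$2) x u)"
  using lct_kernel_complex[of 1 A] by simp

lemma lct_kernel_breve:
  assumes "A$1$2 \<noteq> 0"
  shows "lct_kernel \<mu> (breve A) x u = lct_kernel \<mu> A x u * exp (\<mu> * of_real (A$1$1 / (2 * A$1$2) * x\<^sup>2))"
    and "lct_kernel \<mu> (breve A) x u = exp (\<mu> * of_real (A$1$1 / (2 * A$1$2) * x\<^sup>2)) * lct_kernel \<mu> A x u"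
proof -
  have k: "complex_lct_kernel (2 * a) b d x u = complex_lct_kernel a b d x u * cis (a / (2 * b) * x\<^sup>2)"
    if "b \<noteq> 0" for a b d :: real
  proof -
    have "2 * a / (2 * b) * x\<^sup>2 - 1 / b * x * u + d / (2 * b) * u\<^sup>2 =
        (a / (2 * b) * x\<^sup>2 - 1 / b * x * u + d / (2 * b) * u\<^sup>2) + a / (2 * b) * x\<^sup>2"
      using that by (simp add: field_simps)
    then show ?thesis
      unfolding complex_lct_kernel_def by (simp only: cis_mult[symmetric] mult.assoc)
  qed
  have A: "breve A $ 1 $ 1 = 2 * A$1$1" "breve A $ 1 $ 2 = A$1$2" "breve A $ 2 $ 2 = A$2$2"
    by (simp_all add: breve_def)
  show "lct_kernel \<mu> (breve A) x u = lct_kernel \<mu> A x u * exp (\<mu> * of_real (A$1$1 / (2 * A$1$2) * x\<^sup>2))"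
    unfolding lct_kernel_mu exp_mu quat_of_complex_mult[symmetric] A k[OF assms] ..
  show "lct_kernel \<mu> (breve A) x u = exp (\<mu> * of_real (A$1$1 / (2 * A$1$2) * x\<^sup>2)) * lct_kernel \<mu> A x u"
    unfolding lct_kernel_mu exp_mu quat_of_complex_mult[symmetric] A k[OF assms] by (simp only: mult.commute)
qed

theorem corollary3:
  fixes A1 A2 :: "real^2^2"
    and f g fa fb ga gb :: "real \<times> real \<Rightarrow> quat"
    and p :: enat
    and u v :: real
  assumes "det A1 = 1" and "A1$1$2 \<noteq> 0"
    and "det A2 = 1" and "A2$1$2 \<noteq> 0"
    and "f \<in> Lp 1 \<inter> Lp 2" and "g \<in> Lp 1 \<inter> Lp 2"
    and "1 \<le> p" and "qlct \<mu> \<mu> A1 A2 f \<in> Lp p"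
    and "qlct \<mu> \<mu> A1 A2 g \<in> Lp 1"
    and "\<forall>z. fa z \<in> H_mu \<and> fb z \<in> H_mu \<and> f z = fa z + fb z * \<nu>"
    and "\<forall>z. ga z \<in> H_mu \<and> gb z \<in> H_mu \<and> g z = ga z + \<nu> * qcnj (gb z)"
  shows
    "qlct \<mu> \<mu> A1 A2
       (\<lambda>(x, y). exp (\<mu> * of_real (A1$1$1 / (2 * A1$1$2) * x\<^sup>2)) * f (x, y) * g (x, y)
                 * exp (\<mu> * of_real (A2$1$1 / (2 * A2$1$2) * y\<^sup>2))) (u, v)
     = (spatial_conv \<mu> \<mu> (matrix_inv A1) (matrix_inv A2)
          (qlct \<mu> \<mu> A1 A2 fa) (qlct \<mu> \<mu> A1 A2 ga) (u, v)
        - spatial_conv \<mu> \<mu> (matrix_inv A1) (matrix_inv A2)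
            (qlct \<mu> \<mu> A1 A2 fb) (qlct \<mu> \<mu> A1 A2 (\<lambda>z. qcnj (gb z))) (u, v))
       + (spatial_conv \<mu> (- \<mu>) (matrix_inv A1) (matrix_inv A2)
            (qlct \<mu> (- \<mu>) A1 A2 fb) (qlct \<mu> (- \<mu>) A1 A2 (\<lambda>z. qcnj (ga z))) (u, v)
          + spatial_conv \<mu> (- \<mu>) (matrix_inv A1) (matrix_inv A2)
              (qlct \<mu> (- \<mu>) A1 A2 fa) (qlct \<mu> (- \<mu>) A1 A2 gb) (u, v)) * \<nu>
     \<and>
     qlct \<mu> \<mu> (breve A1) (breve A2) (\<lambda>z. f z * g z) (u, v)
     = (spatial_conv \<mu> \<mu> (matrix_inv A1) (matrix_inv A2)
          (qlct \<mu> \<mu> A1 A2 fa) (qlct \<mu> \<mu> A1 A2 ga) (u, v)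
        - spatial_conv \<mu> \<mu> (matrix_inv A1) (matrix_inv A2)
            (qlct \<mu> \<mu> A1 A2 fb) (qlct \<mu> \<mu> A1 A2 (\<lambda>z. qcnj (gb z))) (u, v))
       + (spatial_conv \<mu> (- \<mu>) (matrix_inv A1) (matrix_inv A2)
            (qlct \<mu> (- \<mu>) A1 A2 fb) (qlct \<mu> (- \<mu>) A1 A2 (\<lambda>z. qcnj (ga z))) (u, v)
          + spatial_conv \<mu> (- \<mu>) (matrix_inv A1) (matrix_inv A2)
              (qlct \<mu> (- \<mu>) A1 A2 fa) (qlct \<mu> (- \<mu>) A1 A2 gb) (u, v)) * \<nu>"
proof -
  define a where "a z = complex_of_quat (f z)" for z
  define b where "b z = complex_of_quat_nu (f z)" for z
  define c where "c z = complex_of_quat (g z)" for z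
  define d where "d z = complex_of_quat_nu (g z)" for z
  note cq = bounded_linear_complex_of_quat norm_complex_of_quat_le(1)
  note cqn = bounded_linear_complex_of_quat_nu norm_complex_of_quat_le(2)
  have a: "integrable lebesgue a" "integrable lebesgue (\<lambda>z. (norm (a z))\<^sup>2)"
    unfolding a_def using Lp_integrable_compose[OF assms(5) cq] by auto
  have b: "integrable lebesgue b" "integrable lebesgue (\<lambda>z. (norm (b z))\<^sup>2)"
    unfolding b_def using Lp_integrable_compose[OF assms(5) cqn] by auto
  have c: "integrable lebesgue c" "integrable lebesgue (\<lambda>z. (norm (c z))\<^sup>2)"
    unfolding c_def using Lp_integrable_compose[OF assms(6) cq] by auto
  have d: "integrable lebesgue d" "integrable lebesgue (\<lambda>z. (norm (d z))\<^sup>2)"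
    unfolding d_def using Lp_integrable_compose[OF assms(6) cqn] by auto
  have c': "integrable lebesgue (\<lambda>z. cnj (c z))" "integrable lebesgue (\<lambda>z. (norm (cnj (c z)))\<^sup>2)"
    and d': "integrable lebesgue (\<lambda>z. cnj (d z))" "integrable lebesgue (\<lambda>z. (norm (cnj (d z)))\<^sup>2)"
    using c d by simp_all
  have fab: "fa = (\<lambda>z. quat_of_complex (a z))" "fb = (\<lambda>z. quat_of_complex (b z))"
    using assms(10) H_mu_components unfolding a_def b_def fun_eq_iff by blast+
  have g': "ga z \<in> H_mu \<and> gb z \<in> H_mu \<and> g z = ga z + gb z * \<nu>" for z
    using assms(11)[rule_format, of z] by (simp add: H_mu_nu)
  have gab: "ga = (\<lambda>z. quat_of_complex (c z))" "gb = (\<lambda>z. quat_of_complex (d z))"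
    using g' H_mu_components unfolding c_def d_def fun_eq_iff by blast+
  have f: "f z = quat_of_complex (a z) + quat_of_complex (b z) * \<nu>" for z
    using assms(10)[rule_format, of z] fab by simp
  have g: "g z = quat_of_complex (c z) + quat_of_complex (d z) * \<nu>" for z
    using g'[of z] gab by simp

  define T where "T \<sigma> p q z = complex_lct_kernel (A1$1$1) (A1$1$2) (A1$2$2) (fst z) u *
      (cis (A1$1$1 / (2 * A1$1$2) * (fst z)\<^sup>2) * (p z * q z) * cis (A2$1$1 / (2 * (\<sigma> * A2$1$2)) * (snd z)\<^sup>2)) *
      complex_lct_kernel (A2$1$1) (\<sigma> * A2$1$2) (A2$2$2) (snd z) v"
    for \<sigma> :: real and p q :: "real \<times> real \<Rightarrow> complex" and z
  note conv = spatial_conv_qlct[OF assms(1-4), where u = u and v = v, folded T_def]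
  define T1 T2 T3 T4 where "T1 = T 1 a c" and "T2 = T 1 b (\<lambda>z. cnj (d z))"
    and "T3 = T (-1) b (\<lambda>z. cnj (c z))" and "T4 = T (-1) a d"
  have I: "integrable lebesgue (\<lambda>z. quat_of_complex (T1 z))" "integrable lebesgue (\<lambda>z. quat_of_complex (T2 z))"
    "integrable lebesgue (\<lambda>z. quat_of_complex (T3 z))" "integrable lebesgue (\<lambda>z. quat_of_complex (T4 z))"
    unfolding T1_def T2_def T3_def T4_def
    using conv(1)[OF _ a c, of 1] conv(1)[OF _ b d', of 1] conv(1)[OF _ b c', of "-1"] conv(1)[OF _ a d, of "-1"]
    by (auto intro!: integrable_bounded_linear[OF bounded_linear_quat_of_complex])
  let ?W = "\<lambda>z. lct_kernel \<mu> A1 (fst z) u * (exp (\<mu> * of_real (A1$1$1 / (2 * A1$1$2) * (fst z)\<^sup>2)) * f z * g z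
      * exp (\<mu> * of_real (A2$1$1 / (2 * A2$1$2) * (snd z)\<^sup>2))) * lct_kernel \<mu> A2 (snd z) v"
  let ?R = "(spatial_conv \<mu> \<mu> (matrix_inv A1) (matrix_inv A2)
          (qlct \<mu> \<mu> A1 A2 fa) (qlct \<mu> \<mu> A1 A2 ga) (u, v)
        - spatial_conv \<mu> \<mu> (matrix_inv A1) (matrix_inv A2)
            (qlct \<mu> \<mu> A1 A2 fb) (qlct \<mu> \<mu> A1 A2 (\<lambda>z. qcnj (gb z))) (u, v))
       + (spatial_conv \<mu> (- \<mu>) (matrix_inv A1) (matrix_inv A2)
            (qlct \<mu> (- \<mu>) A1 A2 fb) (qlct \<mu> (- \<mu>) A1 A2 (\<lambda>z. qcnj (ga z))) (u, v)
          + spatial_conv \<mu> (- \<mu>) (matrix_inv A1) (matrix_inv A2)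
              (qlct \<mu> (- \<mu>) A1 A2 fa) (qlct \<mu> (- \<mu>) A1 A2 gb) (u, v)) * \<nu>"
  have W: "?W z = quat_of_complex (T1 z) - quat_of_complex (T2 z) +
      (quat_of_complex (T3 z) + quat_of_complex (T4 z)) * \<nu>" for z
  proof -
    define k1 where "k1 = complex_lct_kernel (A1$1$1) (A1$1$2) (A1$2$2) (fst z) u"
    define k2 where "k2 = complex_lct_kernel (A2$1$1) (A2$1$2) (A2$2$2) (snd z) v"
    define e1 where "e1 = cis (A1$1$1 / (2 * A1$1$2) * (fst z)\<^sup>2)"
    define e2 where "e2 = cis (A2$1$1 / (2 * A2$1$2) * (snd z)\<^sup>2)"
    have n: "complex_lct_kernel (A2$1$1) (-1 * A2$1$2) (A2$2$2) (snd z) v = cnj k2"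
      "cis (A2$1$1 / (2 * (-1 * A2$1$2)) * (snd z)\<^sup>2) = cnj e2"
      using assms(4) by (simp_all add: k2_def e2_def cnj_complex_lct_kernel cis_cnj)
    have "?W z = quat_of_complex (k1 * e1) *
        ((quat_of_complex (a z) + quat_of_complex (b z) * \<nu>) * (quat_of_complex (c z) + quat_of_complex (d z) * \<nu>)) *
        quat_of_complex (e2 * k2)"
      unfolding f g exp_mu lct_kernel_mu k1_def k2_def e1_def e2_def quat_of_complex_mult
      by (simp only: mult.assoc)
    also have "\<dots> = quat_of_complex ((k1 * e1) * (a z * c z - b z * cnj (d z)) * (e2 * k2)) +
        quat_of_complex ((k1 * e1) * (b z * cnj (c z) + a z * d z) * cnj (e2 * k2)) * \<nu>"
      unfolding quat_mult_components quat_of_complex_conjugated_mult ..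
    also have "(k1 * e1) * (a z * c z - b z * cnj (d z)) * (e2 * k2) = T1 z - T2 z"
      by (simp add: T1_def T2_def T_def k1_def k2_def e1_def e2_def algebra_simps)
    also have "(k1 * e1) * (b z * cnj (c z) + a z * d z) * cnj (e2 * k2) = T3 z + T4 z"
      unfolding T3_def T4_def T_def n by (simp add: k1_def e1_def algebra_simps)
    finally show ?thesis
      by (simp only: quat_of_complex_add quat_of_complex_diff)
  qed
  have "(\<integral>z. ?W z \<partial>lebesgue) = quat_of_complex (\<integral>z. T1 z \<partial>lebesgue) - quat_of_complex (\<integral>z. T2 z \<partial>lebesgue) +
      (quat_of_complex (\<integral>z. T3 z \<partial>lebesgue) + quat_of_complex (\<integral>z. T4 z \<partial>lebesgue)) * \<nu>"
    unfolding W using I by (simp add: integral_quat_of_complex)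
  also have "\<dots> = ?R"
    using conv(2)[OF _ a c, of 1] conv(2)[OF _ b d', of 1] conv(2)[OF _ b c', of "-1"] conv(2)[OF _ a d, of "-1"]
    by (simp add: T1_def T2_def T3_def T4_def fab gab quat_of_complex_cnj)
  finally have R: "(\<integral>z. ?W z \<partial>lebesgue) = ?R" .
  have "qlct \<mu> \<mu> A1 A2
       (\<lambda>(x, y). exp (\<mu> * of_real (A1$1$1 / (2 * A1$1$2) * x\<^sup>2)) * f (x, y) * g (x, y)
                 * exp (\<mu> * of_real (A2$1$1 / (2 * A2$1$2) * y\<^sup>2))) (u, v) = (\<integral>z. ?W z \<partial>lebesgue)"
    by (simp add: qlct_def case_prod_unfold)
  moreover have "qlct \<mu> \<mu> (breve A1) (breve A2) (\<lambda>z. f z * g z) (u, v) = (\<integral>z. ?W z \<partial>lebesgue)"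
    unfolding qlct_def case_prod_unfold lct_kernel_breve(1)[OF assms(2)] lct_kernel_breve(2)[OF assms(4)]
    by (simp add: mult.assoc)
  ultimately show ?thesis
    unfolding R by blast
qed

end
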